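(* Let $L$ be a positive definite even lattice that is generated by a screening system. Then the set of all screeners of $L$ consists of the roots in an orthogonal direct sum of (in general rescaled) root systems, each being one of the following types: $A_1$, $B_2$, $G_2$, $B_3$, $C_3$, $B_4$, $F_4$, $E_6$, $E_7$, $E_8$, $A_n$ for $n\ge 4$, and $B_n$, $C_n$ for $n>4$.
   Context: A positive definite even lattice $L$ is a finitely generated free abelian group with a $\mathbb Z$-valued positive definite symmetric bilinear form $\langle\cdot,\cdot\rangle$ such that $\langle\alpha,\alpha\rangle\in2\mathbb Z$ for all $\alpha\in L$. Put $L^\circ=\{\beta\in\mathbb Q\otimes L:\langle\alpha,\beta\rangle\in\mathbb Z\ \forall\alpha\in L\}$. The set of screeners of $L$ is $\Phi=\{\beta\in L: \beta\notin 2L,\ 2\beta/\langle\beta,\beta\rangle\in L^\circ\}$ (for an even lattice every element has even norm, as the definition of screener requires). A screening system is a linearly independent subset of $\Phi$ (inside $\mathbb C\otimes_{\mathbb Z}L$). $L$ is generated by a screening system if some screening system generates $L$ as an abelian group. Each irreducible component of the root system may be rescaled independently. *)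

theory Defs
  imports "HOL-Analysis.Analysis"
begin

section \<open>Lattices and screeners\<close>

text \<open>
  A positive definite lattice \<open>L\<close> is modelled inside a Euclidean space, with the inner product of
  the space as its form. By positive definiteness and integrality, a \<open>\<int>\<close>-basis of \<open>L\<close> is linearly
  independent over \<open>\<real>\<close>, so the rational (real) span of \<open>L\<close> is \<open>\<rat> \<otimes> L\<close> (\<open>\<real> \<otimes> L\<close>).
\<close>

abbreviation int_scale :: "int \<Rightarrow> 'a::real_vector \<Rightarrow> 'a"
  where "int_scale k x \<equiv> real_of_int k *\<^sub>R x"

abbreviation rat_scale :: "rat \<Rightarrow> 'a::real_vector \<Rightarrow> 'a"
  where "rat_scale q x \<equiv> real_of_rat q *\<^sub>R x"

lemma module_int_scale: "module (int_scale :: int \<Rightarrow> 'a::real_vector \<Rightarrow> 'a)"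
  by unfold_locales (auto simp: algebra_simps)

lemma module_rat_scale: "module (rat_scale :: rat \<Rightarrow> 'a::real_vector \<Rightarrow> 'a)"
  by unfold_locales (auto simp: algebra_simps of_rat_add of_rat_mult)

definition pos_def_even_lattice :: "'a::euclidean_space set \<Rightarrow> bool" where
  "pos_def_even_lattice L \<longleftrightarrow>
     (\<exists>B. finite B \<and> \<not> module.dependent int_scale B \<and> L = module.span int_scale B) \<and>
     (\<forall>\<alpha>\<in>L. \<forall>\<beta>\<in>L. \<alpha> \<bullet> \<beta> \<in> \<int>) \<and>
     (\<forall>\<alpha>\<in>L. \<exists>k::int. \<alpha> \<bullet> \<alpha> = 2 * of_int k)"

definition dual_lattice :: "'a::euclidean_space set \<Rightarrow> 'a set" where
  "dual_lattice L = {\<beta> \<in> module.span rat_scale L. \<forall>\<alpha>\<in>L. \<alpha> \<bullet> \<beta> \<in> \<int>}"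

definition screeners :: "'a::euclidean_space set \<Rightarrow> 'a set" where
  "screeners L =
     {\<beta> \<in> L. \<beta> \<notin> (\<lambda>\<gamma>. 2 *\<^sub>R \<gamma>) ` L \<and> (2 / (\<beta> \<bullet> \<beta>)) *\<^sub>R \<beta> \<in> dual_lattice L}"

text \<open>
  The complexification \<open>\<complex> \<otimes> V\<close> of a real vector space \<open>V\<close> is \<open>V \<times> V\<close>, where \<open>(x, y)\<close> stands
  for \<open>x + \<i>y\<close>. It contains \<open>\<complex> \<otimes> L\<close>, and \<open>x \<in> L\<close> corresponds to \<open>(x, 0)\<close>.
\<close>

definition complex_scale :: "complex \<Rightarrow> 'a::real_vector \<times> 'a \<Rightarrow> 'a \<times> 'a" where
  "complex_scale c z = (Re c *\<^sub>R fst z - Im c *\<^sub>R snd z, Re c *\<^sub>R snd z + Im c *\<^sub>R fst z)"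

lemma module_complex_scale: "module (complex_scale :: complex \<Rightarrow> 'a::real_vector \<times> 'a \<Rightarrow> 'a \<times> 'a)"
  by unfold_locales (auto simp: complex_scale_def algebra_simps)

definition screening_system :: "'a::euclidean_space set \<Rightarrow> 'a set \<Rightarrow> bool" where
  "screening_system L S \<longleftrightarrow>
     S \<subseteq> screeners L \<and> \<not> module.dependent complex_scale ((\<lambda>x. (x, 0)) ` S)"

definition generated_by_screening_system :: "'a::euclidean_space set \<Rightarrow> bool" where
  "generated_by_screening_system L \<longleftrightarrow>
     (\<exists>S. screening_system L S \<and> module.span int_scale S = L)"


section \<open>Root systems\<close>

definition root_reflection :: "'a::euclidean_space \<Rightarrow> 'a \<Rightarrow> 'a" where
  "root_reflection \<alpha> x = x - (2 * (x \<bullet> \<alpha>) / (\<alpha> \<bullet> \<alpha>)) *\<^sub>R \<alpha>"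

text \<open>A reduced crystallographic root system in the subspace that it spans.\<close>

definition root_system :: "'a::euclidean_space set \<Rightarrow> bool" where
  "root_system R \<longleftrightarrow>
     finite R \<and> 0 \<notin> R \<and>
     (\<forall>\<alpha>\<in>R. root_reflection \<alpha> ` R = R) \<and>
     (\<forall>\<alpha>\<in>R. \<forall>\<beta>\<in>R. 2 * (\<beta> \<bullet> \<alpha>) / (\<alpha> \<bullet> \<alpha>) \<in> \<int>) \<and>
     (\<forall>\<alpha>\<in>R. \<forall>c. c *\<^sub>R \<alpha> \<in> R \<longrightarrow> c = 1 \<or> c = -1)"

definition root_base :: "'a::euclidean_space set \<Rightarrow> 'a set \<Rightarrow> bool" where
  "root_base R \<Delta> \<longleftrightarrow>
     \<Delta> \<subseteq> R \<and> finite \<Delta> \<and> independent \<Delta> \<and>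
     (\<forall>\<beta>\<in>R. \<exists>k :: 'a \<Rightarrow> nat.
        \<beta> = (\<Sum>\<delta>\<in>\<Delta>. real (k \<delta>) *\<^sub>R \<delta>) \<or> \<beta> = - (\<Sum>\<delta>\<in>\<Delta>. real (k \<delta>) *\<^sub>R \<delta>))"

text \<open>Only the families \<open>A\<close>, \<open>B\<close>, \<open>C\<close>, \<open>E\<close> and \<open>F\<^sub>4\<close>, \<open>G\<^sub>2\<close> are needed; \<open>D\<close> is left out.\<close>

datatype dynkin_type = Type_A nat | Type_B nat | Type_C nat | Type_E nat | Type_F4 | Type_G2

fun dynkin_rank :: "dynkin_type \<Rightarrow> nat" where
  "dynkin_rank (Type_A n) = n"
| "dynkin_rank (Type_B n) = n"
| "dynkin_rank (Type_C n) = n"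
| "dynkin_rank (Type_E n) = n"
| "dynkin_rank Type_F4 = 4"
| "dynkin_rank Type_G2 = 2"

definition path_entry :: "nat \<Rightarrow> nat \<Rightarrow> int" where
  "path_entry i j = (if i = j then 2 else if i + 1 = j \<or> j + 1 = i then -1 else 0)"

text \<open>
  The Cartan matrices in Bourbaki's numbering of the simple roots \<open>\<alpha>\<^sub>1, \<dots>, \<alpha>\<^sub>n\<close>, with the entry
  at \<open>(i, j)\<close> being \<open>2 \<langle>\<alpha>\<^sub>i, \<alpha>\<^sub>j\<rangle> / \<langle>\<alpha>\<^sub>j, \<alpha>\<^sub>j\<rangle>\<close>: an entry \<open>-2\<close> or \<open>-3\<close> means that \<open>\<alpha>\<^sub>i\<close> is longer
  than \<open>\<alpha>\<^sub>j\<close>. The diagram of \<open>E\<^sub>n\<close> is the path \<open>1, 3, 4, \<dots>, n\<close> with \<open>2\<close> attached to \<open>4\<close>.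
\<close>

fun cartan_entry :: "dynkin_type \<Rightarrow> nat \<Rightarrow> nat \<Rightarrow> int" where
  "cartan_entry (Type_A n) i j = path_entry i j"
| "cartan_entry (Type_B n) i j = (if i + 1 = n \<and> j = n then -2 else path_entry i j)"
| "cartan_entry (Type_C n) i j = (if i = n \<and> j + 1 = n then -2 else path_entry i j)"
| "cartan_entry (Type_E n) i j =
     (if i = j then 2
      else if {i, j} = {1, 3} \<or> {i, j} = {2, 4} then -1
      else if i \<ge> 3 \<and> j \<ge> 3 \<and> (i + 1 = j \<or> j + 1 = i) then -1
      else 0)"
| "cartan_entry Type_F4 i j = (if i = 2 \<and> j = 3 then -2 else path_entry i j)"
| "cartan_entry Type_G2 i j = (if i = 2 \<and> j = 1 then -3 else path_entry i j)"

text \<open>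
  The Cartan matrix determines an irreducible root system up to isometry and rescaling, so
  every rescaled copy of the root system of type \<open>t\<close> is covered.
\<close>

definition rescaled_root_system_of_type :: "'a::euclidean_space set \<Rightarrow> dynkin_type \<Rightarrow> bool" where
  "rescaled_root_system_of_type R t \<longleftrightarrow>
     root_system R \<and>
     (\<exists>a :: nat \<Rightarrow> 'a.
        inj_on a {1..dynkin_rank t} \<and> root_base R (a ` {1..dynkin_rank t}) \<and>
        (\<forall>i\<in>{1..dynkin_rank t}. \<forall>j\<in>{1..dynkin_rank t}.
           2 * (a i \<bullet> a j) / (a j \<bullet> a j) = of_int (cartan_entry t i j)))"

definition roots_of_orthogonal_sum :: "'a::euclidean_space set \<Rightarrow> 'a set set \<Rightarrow> bool" where
  "roots_of_orthogonal_sum R \<C> \<longleftrightarrow>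
     finite \<C> \<and> R = \<Union>\<C> \<and>
     (\<forall>X\<in>\<C>. \<forall>Y\<in>\<C>. X \<noteq> Y \<longrightarrow> (\<forall>x\<in>X. \<forall>y\<in>Y. orthogonal x y))"

end

(*
  The screeners of L are the primitive vectors whose reflections preserve L, so they form a reduced
  root system that spans L and contains every such vector.  Take a base D of it, given by the
  indecomposable positive roots.  The components of D are connected Dynkin diagrams, and the usual
  obstruction (a non-negative combination of simple roots of norm at most 0) leaves only the finite
  types.  If x and y are distinct simple roots, then x - y is not a root, although it is a primitive
  vector of L; hence some Cartan number of x - y with a simple root is not an integer.  Applied to the
  two ends of a fork, to A_2, to the ends of A_3, and to the simple roots 1 and 3 of C_4, this excludes
  D_n, A_2, A_3 and C_4.
*)
theory Submission
  imports Defs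
begin

section \<open>Obtuse systems\<close>

text \<open>The exclusions have a common source: up to scale, A_2, A_3, C_4, D_4 and D_n with n > 4
  have the same root lattice as the larger reduced systems G_2, C_3, F_4, F_4 and C_n. In each case
  \<open>x - y\<close> is one of the additional roots, so testing a single difference of simple
  roots is enough. Such a difference is always a legitimate test vector: the simple roots form a
  basis of L, the coordinate 1 makes \<open>x - y\<close> primitive, and the signs 1 and -1 together
  keep it from being a root. The finite types come from one numerical criterion. After normalisation
  to unit vectors, an arm of k vertices joined to a path by an edge of multiplicity w weighs w k /
  (2 (k + 1)), and the weights of disjoint arms on one path must sum to less than 1. For three
  simple arms at one vertex, with p, q, r denoting the arm lengths plus one, this is 1/p + 1/q + 1/r
  > 1. Normalisation forgets which end of a multiple bond is longer, so one computation covers an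
  affine diagram and its twisted forms; relative lengths matter only when types are named and when
  \<open>x - y\<close> is tested.\<close>

locale obtuse_system =
  fixes C :: "'a::euclidean_space set" and h :: 'a
  assumes finite_C: "finite C"
    and pos: "x \<in> C \<Longrightarrow> 0 < h \<bullet> x"
    and obtuse: "x \<in> C \<Longrightarrow> y \<in> C \<Longrightarrow> x \<noteq> y \<Longrightarrow> x \<bullet> y \<le> 0"
    and cartan_Ints: "x \<in> C \<Longrightarrow> y \<in> C \<Longrightarrow> 2 * (x \<bullet> y) / (y \<bullet> y) \<in> \<int>"
begin

definition adj :: "'a \<Rightarrow> 'a \<Rightarrow> bool" where
  "adj x y \<longleftrightarrow> x \<in> C \<and> y \<in> C \<and> x \<noteq> y \<and> x \<bullet> y \<noteq> 0"

definition cartan_number :: "'a \<Rightarrow> 'a \<Rightarrow> real" where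
  "cartan_number x y = 2 * (x \<bullet> y) / (y \<bullet> y)"

text \<open>The edge multiplicity of the Dynkin diagram, that is 4 cos^2 of the angle. Unlike the
  two Cartan numbers it survives the passage to unit vectors.\<close>

definition bond :: "'a \<Rightarrow> 'a \<Rightarrow> real" where
  "bond x y = cartan_number x y * cartan_number y x"

definition path :: "'a list \<Rightarrow> bool" where
  "path xs \<longleftrightarrow> distinct xs \<and> set xs \<subseteq> C \<and> successively adj xs"

text \<open>Generated step by step instead of by a coefficient function: signs of inner products
  follow by a short induction, and adding the same generator twice is harmless.\<close>

inductive_set cone :: "'a set \<Rightarrow> 'a set" for X where
  zero: "0 \<in> cone X"
| add: "p \<in> cone X \<Longrightarrow> x \<in> X \<Longrightarrow> 0 \<le> c \<Longrightarrow> p + c *\<^sub>R sgn x \<in> cone X"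

definition path_sum :: "'a list \<Rightarrow> 'a" where
  "path_sum xs = (\<Sum>x\<leftarrow>xs. sgn x)"

text \<open>The coefficients fall from the length n at the head, which meets the path, to 1 at the
  far end. The scale \<open>sqrt w / (n + 1)\<close> is the one at which the bound for the square
  and the bound for the contact with the path agree; both are then w n / (2 (n + 1)) in absolute
  value.\<close>

fun arm_sum :: "'a list \<Rightarrow> 'a" where
  "arm_sum [] = 0"
| "arm_sum (y # ys) = real (length (y # ys)) *\<^sub>R sgn y + arm_sum ys"

text \<open>With unit vectors in place of the roots, the sum \<open>p\<close> of a path has \<open>p \<bullet> p \<le> 1\<close>, so adding \<open>a\<close> leaves
  at most \<open>1 - s\<close>: gadgets on the same path whose weights \<open>s\<close> sum to \<open>1\<close> form an affine diagram.\<close>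

definition gadget :: "'a list \<Rightarrow> real \<Rightarrow> 'a set \<Rightarrow> bool" where
  "gadget ps s X \<longleftrightarrow> X \<subseteq> C \<and> (\<exists>a\<in>cone X. a \<bullet> a \<le> s \<and> a \<bullet> path_sum ps \<le> - s)"

section \<open>Unit vectors, non-negative combinations and the affine obstruction\<close>

lemma C_nonzero: "x \<in> C \<Longrightarrow> x \<noteq> 0"
  using pos by fastforce

lemma adj_sym: "adj x y \<Longrightarrow> adj y x"
  by (auto simp: adj_def inner_commute)

lemma bond_sym: "bond x y = bond y x"
  by (simp add: bond_def)

lemma sgn_self: "x \<in> C \<Longrightarrow> sgn x \<bullet> sgn x = 1"
  using C_nonzero[of x] by (simp add: dot_square_norm norm_sgn)

lemma sgn_inner: "sgn x \<bullet> sgn y = (x \<bullet> y) / (norm x * norm y)"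
  by (simp add: sgn_div_norm divide_simps)

lemma sgn_obtuse: "x \<in> C \<Longrightarrow> y \<in> C \<Longrightarrow> x \<noteq> y \<Longrightarrow> sgn x \<bullet> sgn y \<le> 0"
  using obtuse[of x y] by (simp add: sgn_inner divide_nonpos_nonneg)

lemma bond_eq: "bond x y = 4 * (sgn x \<bullet> sgn y)\<^sup>2"
  unfolding bond_def cartan_number_def sgn_inner
  by (simp add: dot_square_norm inner_commute[of y x] power2_eq_square)

lemma sgn_bond:
  assumes "adj x y" shows "sgn x \<bullet> sgn y = - sqrt (bond x y) / 2"
proof -
  have "sgn x \<bullet> sgn y \<le> 0" using assms sgn_obtuse by (auto simp: adj_def)
  then have "sqrt (bond x y) = 2 * (- (sgn x \<bullet> sgn y))"
    by (simp add: bond_eq real_sqrt_mult)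
  then show ?thesis by simp
qed

lemma cartan_number_neg: "adj x y \<Longrightarrow> cartan_number x y < 0"
  using obtuse[of x y] C_nonzero[of y] divide_neg_pos[of "2 * (x \<bullet> y)" "y \<bullet> y"]
  unfolding adj_def cartan_number_def by auto

lemma cartan_number_int: "x \<in> C \<Longrightarrow> y \<in> C \<Longrightarrow> \<exists>k::int. cartan_number x y = of_int k"
  using cartan_Ints[of x y] unfolding cartan_number_def by (auto elim: Ints_cases)

lemma cartan_number_le: "adj x y \<Longrightarrow> cartan_number x y \<le> -1"
  using cartan_number_neg[of x y] cartan_number_int[of x y] unfolding adj_def by force

lemma bond_ge: "adj x y \<Longrightarrow> 1 \<le> bond x y"
  using cartan_number_le[of x y] cartan_number_le[of y x] adj_sym[of x y] mult_mono[of 1 "- cartan_number x y" 1 "- cartan_number y x"]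
  unfolding bond_def by simp

lemma sgn_adj: "adj x y \<Longrightarrow> sgn x \<bullet> sgn y \<le> - 1 / 2"
  using sgn_bond[of x y] bond_ge[of x y] by simp

lemma cone_inner:
  assumes "p \<in> cone X" and "\<And>x. x \<in> X \<Longrightarrow> sgn x \<bullet> q \<le> 0"
  shows "p \<bullet> q \<le> 0"
  using assms(1)
proof induction
  case (add p x c)
  then show ?case using assms(2)[of x] by (simp add: inner_add_left mult_nonneg_nonpos add_nonpos_nonpos)
qed simp

lemma cone_cone:
  assumes "p \<in> cone X" "q \<in> cone Y" "X \<subseteq> C" "Y \<subseteq> C" "X \<inter> Y = {}"
  shows "p \<bullet> q \<le> 0"
proof (rule cone_inner[OF assms(1)])
  fix x assume x: "x \<in> X"
  have "q \<bullet> sgn x \<le> 0"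
    by (rule cone_inner[OF assms(2)]) (use x assms in \<open>auto intro!: sgn_obtuse\<close>)
  then show "sgn x \<bullet> q \<le> 0" by (simp add: inner_commute)
qed

lemma cone_pos:
  assumes "p \<in> cone X" "X \<subseteq> C" shows "0 \<le> h \<bullet> p"
proof -
  have "p \<bullet> (- h) \<le> 0"
  proof (rule cone_inner[OF assms(1)])
    fix x assume "x \<in> X"
    then have "0 < h \<bullet> x" using assms pos by auto
    then show "sgn x \<bullet> - h \<le> 0" by (simp add: sgn_div_norm inner_commute)
  qed
  then show ?thesis by (simp add: inner_commute)
qed

lemma cone_plus: "q \<in> cone X \<Longrightarrow> p \<in> cone X \<Longrightarrow> p + q \<in> cone X"
  by (induction rule: cone.induct) (auto simp: add.assoc[symmetric] intro: cone.intros)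

lemma cone_scale: "p \<in> cone X \<Longrightarrow> 0 \<le> c \<Longrightarrow> c *\<^sub>R p \<in> cone X"
  by (induction rule: cone.induct) (auto simp: scaleR_add_right intro: cone.intros)

lemma cone_mono: "p \<in> cone X \<Longrightarrow> X \<subseteq> Y \<Longrightarrow> p \<in> cone Y"
  by (induction rule: cone.induct) (auto intro: cone.intros)

lemma cone_base: "x \<in> X \<Longrightarrow> 0 \<le> c \<Longrightarrow> c *\<^sub>R sgn x \<in> cone X"
  using cone.add[OF cone.zero, of x X c] by simp

lemma path_sum_cone: "path_sum xs \<in> cone (set xs)"
proof (induction xs)
  case (Cons x xs)
  have "1 *\<^sub>R sgn x \<in> cone (set (x # xs))" by (rule cone_base) auto
  moreover have "path_sum xs \<in> cone (set (x # xs))" by (rule cone_mono[OF Cons]) auto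
  ultimately show ?case using cone_plus by (fastforce simp: path_sum_def)
qed (simp add: path_sum_def cone.zero)

lemma arm_sum_cone: "arm_sum xs \<in> cone (set xs)"
proof (induction xs)
  case (Cons x xs)
  have "real (length (x # xs)) *\<^sub>R sgn x \<in> cone (set (x # xs))" by (rule cone_base) auto
  moreover have "arm_sum xs \<in> cone (set (x # xs))" by (rule cone_mono[OF Cons]) auto
  ultimately show ?case using cone_plus by (simp only: arm_sum.simps)
qed (simp add: cone.zero)

lemma path_Cons: "path (x # xs) \<Longrightarrow> path xs"
  by (cases xs) (auto simp: path_def)

lemma cone_sgn:
  assumes "p \<in> cone X" "X \<subseteq> C" "x \<in> C" "x \<notin> X" shows "sgn x \<bullet> p \<le> 0"
  using cone_inner[OF assms(1), of "sgn x"] sgn_obtuse[of _ x] assms by (auto simp: inner_commute)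

text \<open>Each new vertex adds 1 by its own square and removes at least 1 by its edge to the next
  vertex; all other products are non-positive.\<close>

lemma path_sum_norm: "path xs \<Longrightarrow> path_sum xs \<bullet> path_sum xs \<le> 1"
proof (induction xs)
  case (Cons x xs)
  have IH: "path_sum xs \<bullet> path_sum xs \<le> 1" using Cons path_Cons by blast
  show ?case
  proof (cases xs)
    case Nil
    then show ?thesis using Cons.prems sgn_self[of x] by (simp add: path_sum_def path_def)
  next
    case (Cons y ys)
    have pth: "path (x # y # ys)" using Cons.prems Cons by simp
    have "sgn x \<bullet> path_sum ys \<le> 0"
      by (rule cone_sgn[OF path_sum_cone]) (use pth in \<open>auto simp: path_def\<close>)
    moreover have "sgn x \<bullet> sgn y \<le> -1/2" using pth sgn_adj by (simp add: path_def)
    ultimately have "sgn x \<bullet> path_sum xs \<le> -1/2" using Cons by (simp add: path_sum_def inner_add_right)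
    moreover have "sgn x \<bullet> sgn x = 1" using pth sgn_self by (simp add: path_def)
    moreover have "path_sum (x # xs) = sgn x + path_sum xs" by (simp add: path_sum_def)
    ultimately show ?thesis using IH
      by (simp add: inner_add_left inner_add_right inner_commute[of "path_sum xs" "sgn x"])
  qed
qed (simp add: path_sum_def)

text \<open>With k vertices already present, the new one adds (k + 1)^2 and its edge removes at
  least k (k + 1), a net gain of at most k + 1, as for triangular numbers.\<close>

lemma arm_sum_norm:
  "path xs \<Longrightarrow> arm_sum xs \<bullet> arm_sum xs \<le> real (length xs) * (real (length xs) + 1) / 2"
proof (induction xs)
  case (Cons x xs)
  define k where "k = real (length xs)"
  have k: "0 \<le> k" by (simp add: k_def)
  have IH: "arm_sum xs \<bullet> arm_sum xs \<le> k * (k + 1) / 2" using Cons path_Cons by (simp add: k_def)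
  have xx: "sgn x \<bullet> sgn x = 1" using Cons.prems sgn_self by (simp add: path_def)
  have b: "sgn x \<bullet> arm_sum xs \<le> - k / 2"
  proof (cases xs)
    case Nil
    then show ?thesis by (simp add: k_def)
  next
    case (Cons y ys)
    have pth: "path (x # y # ys)" using Cons.prems Cons by simp
    have "sgn x \<bullet> arm_sum ys \<le> 0"
      by (rule cone_sgn[OF arm_sum_cone]) (use pth in \<open>auto simp: path_def\<close>)
    moreover have "sgn x \<bullet> sgn y \<le> -1/2" using pth sgn_adj by (simp add: path_def)
    then have "k * (sgn x \<bullet> sgn y) \<le> k * (-1/2)" using k by (intro mult_left_mono)
    moreover have "arm_sum xs = k *\<^sub>R sgn y + arm_sum ys" using Cons by (simp add: k_def)
    ultimately show ?thesis by (simp add: inner_add_right)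
  qed
  have "arm_sum (x # xs) = (k + 1) *\<^sub>R sgn x + arm_sum xs" by (simp add: k_def add.commute)
  then have "arm_sum (x # xs) \<bullet> arm_sum (x # xs)
      = (k + 1)\<^sup>2 + 2 * (k + 1) * (sgn x \<bullet> arm_sum xs) + arm_sum xs \<bullet> arm_sum xs"
    using xx
    by (simp del: arm_sum.simps add: inner_add_left inner_add_right
        inner_commute[of "arm_sum xs" "sgn x"] power2_eq_square, simp add: algebra_simps)
  also have "\<dots> \<le> (k + 1)\<^sup>2 + 2 * (k + 1) * (- k / 2) + k * (k + 1) / 2"
    using IH b k by (intro add_mono mult_left_mono) auto
  also have "\<dots> = (k + 1) * (k + 1 + 1) / 2" by (simp add: power2_eq_square field_simps)
  finally show ?case by (simp add: k_def add.commute)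
qed simp

lemma path_sum_split: "x \<in> set xs \<Longrightarrow> \<exists>q\<in>cone (set xs). path_sum xs = sgn x + q"
proof (induction xs)
  case (Cons y ys)
  show ?case
  proof (cases "x = y")
    case True
    then show ?thesis using cone_mono[OF path_sum_cone, of ys "set (y # ys)"]
      by (intro bexI[of _ "path_sum ys"]) (auto simp: path_sum_def)
  next
    case False
    then obtain q where q: "q \<in> cone (set ys)" "path_sum ys = sgn x + q" using Cons by auto
    have "1 *\<^sub>R sgn y + q \<in> cone (set (y # ys))"
      by (intro cone_plus cone_base cone_mono[OF q(1)]) auto
    then show ?thesis using q by (intro bexI[of _ "sgn y + q"]) (auto simp: path_sum_def algebra_simps)
  qed
qed simp

text \<open>Lets a gadget be estimated at its point of contact alone: the other vertices of the path
  can only lower the inner product.\<close>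

lemma cone_path_sum_le:
  assumes "a \<in> cone X" "X \<subseteq> C" "path ps" "c \<in> set ps" "X \<inter> set ps = {}"
  shows "a \<bullet> path_sum ps \<le> a \<bullet> sgn c"
proof -
  obtain q where q: "q \<in> cone (set ps)" "path_sum ps = sgn c + q" using path_sum_split assms by blast
  have "a \<bullet> q \<le> 0" by (rule cone_cone[OF assms(1) q(1)]) (use assms in \<open>auto simp: path_def\<close>)
  then show ?thesis using q by (simp add: inner_add_right)
qed

text \<open>Coefficients along an arm decrease linearly to zero, as in the affine diagrams.\<close>

lemma gadget_arm:
  assumes "path ps" "c \<in> set ps" "path ys" "ys \<noteq> []" "set ys \<inter> set ps = {}"
    and "adj c (hd ys)" "0 \<le> w" "w \<le> bond c (hd ys)"
  shows "gadget ps (w * length ys / (2 * (length ys + 1))) (set ys)"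
proof -
  define k where "k = real (length ys)"
  have k: "0 \<le> k" by (simp add: k_def)
  define a where "a = (sqrt w / (k + 1)) *\<^sub>R arm_sum ys"
  have a: "a \<in> cone (set ys)" unfolding a_def using k assms by (intro cone_scale arm_sum_cone) auto
  obtain y zs where ys: "ys = y # zs" using assms by (cases ys) auto
  have c: "c \<in> C" using assms by (auto simp: path_def)
  have "a \<bullet> a = w / (k + 1)\<^sup>2 * (arm_sum ys \<bullet> arm_sum ys)"
    using assms by (simp add: a_def power2_eq_square)
  also have "\<dots> \<le> w / (k + 1)\<^sup>2 * (k * (k + 1) / 2)"
    using arm_sum_norm[of ys] assms by (intro mult_left_mono) (auto simp: k_def)
  also have "\<dots> = w * k / (2 * (k + 1))" using k by (simp add: power2_eq_square divide_simps)
  finally have 1: "a \<bullet> a \<le> w * k / (2 * (k + 1))" .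
  have "sgn c \<bullet> arm_sum zs \<le> 0"
    by (rule cone_sgn[OF arm_sum_cone]) (use assms ys in \<open>auto simp: path_def\<close>)
  moreover have "sgn c \<bullet> sgn y \<le> - sqrt w / 2"
    using sgn_bond[of c y] assms ys by simp
  then have "k * (sgn c \<bullet> sgn y) \<le> k * (- sqrt w / 2)" using k by (intro mult_left_mono)
  moreover have "arm_sum ys = k *\<^sub>R sgn y + arm_sum zs" using ys by (simp add: k_def)
  ultimately have "sgn c \<bullet> arm_sum ys \<le> k * (- sqrt w / 2)" by (simp add: inner_add_right)
  then have "sqrt w / (k + 1) * (sgn c \<bullet> arm_sum ys) \<le> sqrt w / (k + 1) * (k * (- sqrt w / 2))"
    using k assms by (intro mult_left_mono) auto
  also have "r / (k + 1) * (k * (- r / 2)) = - ((r * r) * k / (2 * (k + 1)))" for r :: real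
    by (simp add: field_simps)
  then have "sqrt w / (k + 1) * (k * (- sqrt w / 2)) = - ((sqrt w * sqrt w) * k / (2 * (k + 1)))" .
  also have "sqrt w * sqrt w = w" using assms by simp
  finally have "a \<bullet> sgn c \<le> - (w * k / (2 * (k + 1)))" by (simp add: a_def inner_commute)
  moreover have "a \<bullet> path_sum ps \<le> a \<bullet> sgn c"
    by (rule cone_path_sum_le[OF a]) (use assms in \<open>auto simp: path_def\<close>)
  ultimately have "a \<bullet> path_sum ps \<le> - (w * k / (2 * (k + 1)))" by simp
  then show ?thesis using 1 a assms unfolding gadget_def k_def path_def by (auto simp: add.commute)
qed

text \<open>Disjoint supports meet at obtuse angles, so the mixed term only helps and the weights
  add.\<close>

lemma gadget_plus:
  assumes "gadget ps s X" "gadget ps t Y" "X \<inter> Y = {}"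
  shows "gadget ps (s + t) (X \<union> Y)"
proof -
  obtain a b where a: "a \<in> cone X" "a \<bullet> a \<le> s" "a \<bullet> path_sum ps \<le> - s"
    and b: "b \<in> cone Y" "b \<bullet> b \<le> t" "b \<bullet> path_sum ps \<le> - t"
    and XY: "X \<subseteq> C" "Y \<subseteq> C"
    using assms unfolding gadget_def by auto
  have "a + b \<in> cone (X \<union> Y)" using a b by (intro cone_plus) (auto elim: cone_mono)
  moreover have "a \<bullet> b \<le> 0" by (rule cone_cone[OF a(1) b(1) XY assms(3)])
  ultimately show ?thesis using a b XY unfolding gadget_def
    by (intro conjI bexI[of _ "a + b"])
      (auto simp: inner_add_left inner_add_right inner_commute[of b a])
qed

text \<open>Gadget plus path has square at most 1 - s, so it vanishes. But \<open>h\<close> is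
  positive on it: the path contributes strictly, the gadget at least 0. In this argument
  \<open>h\<close> does the work of linear independence.\<close>

lemma no_gadget:
  assumes "gadget ps s X" "path ps" "ps \<noteq> []" "1 \<le> s"
  shows False
proof -
  obtain a where a: "a \<in> cone X" "a \<bullet> a \<le> s" "a \<bullet> path_sum ps \<le> - s" and X: "X \<subseteq> C"
    using assms unfolding gadget_def by auto
  obtain x xs where ps: "ps = x # xs" using assms by (cases ps) auto
  have x: "x \<in> C" "set xs \<subseteq> C" using ps assms by (auto simp: path_def)
  have "0 < h \<bullet> sgn x" using pos[OF x(1)] C_nonzero[OF x(1)] by (simp add: sgn_div_norm)
  moreover have "0 \<le> h \<bullet> path_sum xs" by (rule cone_pos[OF path_sum_cone x(2)])
  ultimately have "0 < h \<bullet> path_sum ps" by (simp add: ps path_sum_def inner_add_right)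
  moreover have "0 \<le> h \<bullet> a" by (rule cone_pos[OF a(1) X])
  ultimately have "0 < h \<bullet> (a + path_sum ps)" by (simp add: inner_add_right)
  moreover have "(a + path_sum ps) \<bullet> (a + path_sum ps) \<le> 0"
    using a path_sum_norm[OF assms(2)] assms(4)
    by (simp add: inner_add_left inner_add_right inner_commute[of "path_sum ps" a])
  then have "a + path_sum ps = 0" using inner_ge_zero[of "a + path_sum ps"] inner_eq_zero_iff by fastforce
  ultimately show False by simp
qed

text \<open>The affine diagram of type A. Two contacts of -1/2 or less make the single vertex
  \<open>y\<close> a gadget of weight 1.\<close>

lemma no_cycle:
  assumes "path ps" "y \<notin> set ps" "adj y c" "adj y d" "c \<in> set ps" "d \<in> set ps" "c \<noteq> d"
  shows False
proof -
  have "path ps \<Longrightarrow> y \<notin> set ps \<Longrightarrow> c \<in> set ps \<Longrightarrow> d \<in> set ps \<Longrightarrow> sgn y \<bullet> path_sum ps \<le> -1" for ps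
  proof (induction ps)
    case (Cons x xs)
    have x: "y \<in> C" "x \<in> C" "y \<noteq> x" "set xs \<subseteq> C" "x \<notin> set xs"
      using Cons.prems assms by (auto simp: path_def adj_def)
    have yx: "sgn y \<bullet> sgn x \<le> 0" using x by (intro sgn_obtuse)
    have e: "path_sum (x # xs) = sgn x + path_sum xs" by (simp add: path_sum_def)
    have A: "sgn y \<bullet> path_sum xs \<le> -1/2" if z: "z \<in> set xs" "adj y z" for z
    proof -
      have "(1 *\<^sub>R sgn y) \<bullet> path_sum xs \<le> (1 *\<^sub>R sgn y) \<bullet> sgn z"
        by (rule cone_path_sum_le[OF cone_base[of y "{y}"]])
          (use Cons.prems x z path_Cons in auto)
      then show ?thesis using sgn_adj[OF z(2)] by simp
    qed
    show ?case
    proof (cases "x = c \<or> x = d")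
      case True
      then have "sgn y \<bullet> path_sum xs \<le> -1/2" using A assms Cons.prems by auto
      moreover have "sgn y \<bullet> sgn x \<le> -1/2" using True assms sgn_adj by blast
      ultimately show ?thesis by (simp add: e inner_add_right)
    next
      case False
      then have "sgn y \<bullet> path_sum xs \<le> -1" using Cons path_Cons by auto
      then show ?thesis using yx by (simp add: e inner_add_right)
    qed
  qed simp
  then have "sgn y \<bullet> path_sum ps \<le> -1" using assms by blast
  moreover have "1 *\<^sub>R sgn y \<in> cone {y}" by (rule cone_base) auto
  moreover have "y \<in> C" using assms by (simp add: adj_def)
  ultimately have "gadget ps 1 {y}" using sgn_self[of y] unfolding gadget_def
    by (intro conjI bexI[of _ "sgn y"]) auto
  then show False using no_gadget assms by fastforce
qed

end

text \<open>The Cartan matrix clause of \<open>rescaled_root_system_of_type\<close> with the set of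
  simple roots prescribed, so that a diagram can be named without mentioning its root
  system.\<close>

definition has_cartan_type :: "'a::euclidean_space set \<Rightarrow> dynkin_type \<Rightarrow> bool" where
  "has_cartan_type C t \<longleftrightarrow> (\<exists>a :: nat \<Rightarrow> 'a.
     inj_on a {1..dynkin_rank t} \<and> a ` {1..dynkin_rank t} = C \<and>
     (\<forall>i\<in>{1..dynkin_rank t}. \<forall>j\<in>{1..dynkin_rank t}.
        2 * (a i \<bullet> a j) / (a j \<bullet> a j) = of_int (cartan_entry t i j)))"

definition maximal_types :: "dynkin_type set" where
  "maximal_types = {Type_A 1, Type_B 2, Type_G2, Type_B 3, Type_C 3, Type_B 4, Type_F4,
                    Type_E 6, Type_E 7, Type_E 8}
                \<union> {Type_A n | n. n \<ge> 4} \<union> {Type_B n | n. n > 4} \<union> {Type_C n | n. n > 4}"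

definition seg :: "'a list \<Rightarrow> nat \<Rightarrow> nat \<Rightarrow> 'a list" where
  "seg xs i j = map ((!) xs) [i..<Suc j]"

lemma set_seg: "set (seg xs i j) = (!) xs ` {i..j}"
  unfolding seg_def by (auto simp del: upt_Suc)

lemma length_seg: "length (seg xs i j) = Suc j - i"
  unfolding seg_def by (simp del: upt_Suc)

lemma nth_seg: "k < Suc j - i \<Longrightarrow> seg xs i j ! k = xs ! (i + k)"
  unfolding seg_def by (simp del: upt_Suc)

lemma path_entry_Suc [simp]: "path_entry (Suc i) (Suc j) = path_entry i j"
  by (simp add: path_entry_def)

section \<open>Segments of paths, possible bonds, and bonds near a branch point\<close>

context obtuse_system
begin

lemma path_single: "x \<in> C \<Longrightarrow> path [x]"
  by (simp add: path_def)

lemma path_length: "path xs \<Longrightarrow> length xs \<le> card C"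
  unfolding path_def using finite_C by (metis card_mono distinct_card)

lemma path_rev: "path (rev xs) \<longleftrightarrow> path xs"
  unfolding path_def by (auto simp: successively_rev elim!: successively_mono intro: adj_sym)

lemma path_ConsI:
  "path xs \<Longrightarrow> xs \<noteq> [] \<Longrightarrow> v \<notin> set xs \<Longrightarrow> adj v (hd xs) \<Longrightarrow> path (v # xs)"
  by (cases xs) (auto simp: path_def adj_def)

lemma path_nth_adj: "path xs \<Longrightarrow> Suc i < length xs \<Longrightarrow> adj (xs ! i) (xs ! Suc i)"
  by (auto simp: path_def successively_conv_nth)

lemma path_nth_C: "path xs \<Longrightarrow> i < length xs \<Longrightarrow> xs ! i \<in> C"
  by (auto simp: path_def)

lemma path_nth_eq: "path xs \<Longrightarrow> i < length xs \<Longrightarrow> j < length xs \<Longrightarrow> xs ! i = xs ! j \<longleftrightarrow> i = j"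
  by (auto simp: path_def nth_eq_iff_index_eq)

lemma path_seg:
  assumes "path xs" "i \<le> j" "j < length xs" shows "path (seg xs i j)"
proof -
  have "distinct (seg xs i j)" unfolding seg_def
    using path_nth_eq[OF assms(1)] assms by (auto simp: distinct_map inj_on_def simp del: upt_Suc)
  moreover have "set (seg xs i j) \<subseteq> C" using assms path_nth_C by (auto simp: set_seg)
  moreover have "successively adj (seg xs i j)"
    using assms path_nth_adj by (auto simp: successively_conv_nth length_seg nth_seg)
  ultimately show ?thesis by (simp add: path_def)
qed

lemma seg_ne: "i \<le> j \<Longrightarrow> seg xs i j \<noteq> []"
  by (auto simp: seg_def)

lemma hd_seg: "i \<le> j \<Longrightarrow> hd (seg xs i j) = xs ! i"
  using nth_seg[of 0 j i xs] seg_ne[of i j xs] by (simp add: hd_conv_nth)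

lemma last_seg: "i \<le> j \<Longrightarrow> last (seg xs i j) = xs ! j"
  unfolding seg_def by simp

lemma nth_in_seg: "i \<le> k \<Longrightarrow> k \<le> j \<Longrightarrow> xs ! k \<in> set (seg xs i j)"
  by (auto simp: set_seg)

lemma nth_seg_iff:
  "path xs \<Longrightarrow> j < length xs \<Longrightarrow> k < length xs \<Longrightarrow> xs ! k \<in> set (seg xs i j) \<longleftrightarrow> i \<le> k \<and> k \<le> j"
  by (auto simp: set_seg path_nth_eq)

lemma out_notin_seg: "v \<notin> set xs \<Longrightarrow> j < length xs \<Longrightarrow> v \<notin> set (seg xs i j)"
  by (auto simp: set_seg)

text \<open>An edge that skips vertices would close a cycle with the segment between its ends, so
  paths are induced subgraphs.\<close>

lemma chord:
  assumes "path xs" "i < j" "j < length xs" "adj (xs ! i) (xs ! j)" shows "j = Suc i"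
proof (rule ccontr)
  assume "j \<noteq> Suc i"
  then have j: "Suc i < j" using assms by simp
  show False
  proof (rule no_cycle)
    show "path (seg xs (Suc i) j)" using assms j by (intro path_seg) auto
    show "xs ! i \<notin> set (seg xs (Suc i) j)" using assms j by (simp add: nth_seg_iff)
    show "adj (xs ! i) (xs ! Suc i)" using assms j by (intro path_nth_adj) auto
    show "adj (xs ! i) (xs ! j)" by fact
    show "xs ! Suc i \<in> set (seg xs (Suc i) j)" using j by (intro nth_in_seg) auto
    show "xs ! j \<in> set (seg xs (Suc i) j)" using j by (intro nth_in_seg) auto
    show "xs ! Suc i \<noteq> xs ! j" using assms j by (simp add: path_nth_eq)
  qed
qed

lemma gadget_leaf:
  assumes "path ps" "c \<in> set ps" "adj c y" "y \<notin> set ps" "0 \<le> w" "w \<le> bond c y"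
  shows "gadget ps (w / 4) {y}"
  using gadget_arm[OF assms(1,2) path_single[of y], of w] assms by (simp add: adj_def)

lemma gadget_leaf_simple:
  assumes "path ps" "c \<in> set ps" "adj c y" "y \<notin> set ps"
  shows "gadget ps (1 / 4) {y}"
  using gadget_leaf[OF assms, of 1] bond_ge[OF assms(3)] by simp

lemma gadget_arm_simple:
  assumes "path ps" "c \<in> set ps" "path ys" "ys \<noteq> []" "set ys \<inter> set ps = {}" "adj c (hd ys)"
  shows "gadget ps (real (length ys) / real (2 * (length ys + 1))) (set ys)"
  using gadget_arm[OF assms, of 1] bond_ge[OF assms(6)] by simp

lemma no_two_gadgets:
  assumes "path ps" "ps \<noteq> []" "gadget ps s X" "gadget ps t Y" "X \<inter> Y = {}" "1 \<le> s + t"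
  shows False
  using no_gadget[OF gadget_plus[OF assms(3,4,5)] assms(1,2,6)] .

lemma no_three_gadgets:
  assumes "path ps" "ps \<noteq> []" "gadget ps s X" "gadget ps t Y" "gadget ps u Z"
    and "X \<inter> Y = {}" "X \<inter> Z = {}" "Y \<inter> Z = {}" "1 \<le> s + t + u"
  shows False
  using no_two_gadgets[OF assms(1,2) gadget_plus[OF assms(3,4,6)] assms(5)] assms(7-9) by auto

lemma no_four_gadgets:
  assumes "path ps" "ps \<noteq> []" "gadget ps s X" "gadget ps t Y" "gadget ps u Z" "gadget ps r W"
    and "X \<inter> Y = {}" "X \<inter> Z = {}" "X \<inter> W = {}" "Y \<inter> Z = {}" "Y \<inter> W = {}" "Z \<inter> W = {}"
    and "1 \<le> s + t + u + r"
  shows False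
  using no_three_gadgets[OF assms(1,2) gadget_plus[OF assms(3,4,7)] assms(5,6)] assms(8-13) by auto

text \<open>The affine diagrams of rank 1: across a bond of at least 4 a single leaf already has
  weight 4/4.\<close>

lemma bond_less_4: assumes "adj x y" shows "bond x y < 4"
proof (rule ccontr)
  assume "\<not> bond x y < 4"
  then have "gadget [x] (4 / 4) {y}"
    using assms by (intro gadget_leaf[of "[x]" x]) (auto simp: adj_def path_single)
  then show False using no_gadget[of "[x]" 1 "{y}"] assms by (auto simp: adj_def path_single)
qed

lemma cartan_number_self: "x \<in> C \<Longrightarrow> cartan_number x x = 2"
  using C_nonzero[of x] by (simp add: cartan_number_def)

lemma cartan_number_nonadj: "x \<in> C \<Longrightarrow> y \<in> C \<Longrightarrow> x \<noteq> y \<Longrightarrow> \<not> adj x y \<Longrightarrow> cartan_number x y = 0"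
  by (simp add: adj_def cartan_number_def)

text \<open>Both Cartan numbers are negative integers and their product is below 4. Equality of
  lengths is recorded only for the simple bond, where the two numbers coincide.\<close>

lemma cartan_number_cases:
  assumes "adj x y"
  obtains "bond x y = 1" "cartan_number x y = -1" "cartan_number y x = -1" "x \<bullet> x = y \<bullet> y"
  | "bond x y = 2" "cartan_number x y = -1" "cartan_number y x = -2"
  | "bond x y = 2" "cartan_number x y = -2" "cartan_number y x = -1"
  | "bond x y = 3" "cartan_number x y = -1" "cartan_number y x = -3"
  | "bond x y = 3" "cartan_number x y = -3" "cartan_number y x = -1"
proof -
  obtain m n :: int where mn: "cartan_number x y = of_int m" "cartan_number y x = of_int n"
    using cartan_number_int assms unfolding adj_def by metis
  have m: "m \<le> -1" "n \<le> -1" using cartan_number_le[OF assms] cartan_number_le[OF adj_sym[OF assms]] mn by linarith+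
  have b: "bond x y = of_int (m * n)" by (simp add: bond_def mn)
  then have "of_int (m * n) < (4::real)" using bond_less_4[OF assms] by simp
  then have l: "m * n < 4" by linarith
  have "- m \<le> m * n" using mult_left_mono_neg[of n "-1" m] m by simp
  moreover have "- n \<le> m * n" using mult_right_mono_neg[of m "-1" n] m by simp
  ultimately have "m \<in> {-3, -2, -1}" "n \<in> {-3, -2, -1}" using l m by auto
  then have mm: "(m, n) \<in> {(-1, -1), (-1, -2), (-2, -1), (-1, -3), (-3, -1)}" using l by auto
  have "x \<bullet> x = y \<bullet> y" if "cartan_number x y = -1" "cartan_number y x = -1"
    using that C_nonzero[of x] C_nonzero[of y] assms
    by (auto simp: cartan_number_def adj_def inner_commute[of y x] field_simps)
  then show ?thesis using that mm mn b by auto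
qed

text \<open>The bond hypothesis concerns only a possible edge between the two chosen vertices, so
  the lemma also serves paths that have a multiple bond elsewhere.\<close>

lemma path_cartan:
  assumes "path xs" "a < length xs" "b < length xs"
    and "\<And>k. Suc k < length xs \<Longrightarrow> a = k \<and> b = Suc k \<or> a = Suc k \<and> b = k \<Longrightarrow>
      bond (xs ! k) (xs ! Suc k) = 1"
  shows "cartan_number (xs ! a) (xs ! b) = of_int (path_entry a b)"
proof -
  have one: "cartan_number (xs ! k) (xs ! Suc k) = -1 \<and> cartan_number (xs ! Suc k) (xs ! k) = -1"
    if "Suc k < length xs" "a = k \<and> b = Suc k \<or> a = Suc k \<and> b = k" for k
    using assms(4)[OF that] path_nth_adj[OF assms(1) that(1)] by (auto elim: cartan_number_cases)
  consider "a = b" | "b = Suc a" | "a = Suc b" | "a \<noteq> b" "b \<noteq> Suc a" "a \<noteq> Suc b" by blast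
  then show ?thesis
  proof cases
    case 1
    then show ?thesis using assms path_nth_C cartan_number_self by (simp add: path_entry_def)
  next
    case 2
    then show ?thesis using one[of a] assms by (simp add: path_entry_def)
  next
    case 3
    then show ?thesis using one[of b] assms by (simp add: path_entry_def)
  next
    case 4
    then have "\<not> adj (xs ! a) (xs ! b)"
      using chord[OF assms(1), of a b] chord[OF assms(1), of b a] assms adj_sym by (metis nat_neq_iff)
    then show ?thesis using 4 assms path_nth_C path_nth_eq by (simp add: path_entry_def cartan_number_nonadj)
  qed
qed

lemma has_cartan_typeI:
  assumes "distinct ys" "set ys = C" "length ys = dynkin_rank t"
    and "\<And>i j. i < length ys \<Longrightarrow> j < length ys \<Longrightarrow>
      cartan_number (ys ! i) (ys ! j) = of_int (cartan_entry t (Suc i) (Suc j))"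
  shows "has_cartan_type C t"
  unfolding has_cartan_type_def
proof (intro exI conjI ballI)
  \<comment> \<open>Lists are indexed from 0, Bourbaki's simple roots from 1.\<close>
  let ?a = "\<lambda>i. ys ! (i - 1)"
  show "inj_on ?a {1..dynkin_rank t}"
    using assms by (auto simp: inj_on_def nth_eq_iff_index_eq)
  show "?a ` {1..dynkin_rank t} = C"
  proof
    show "?a ` {1..dynkin_rank t} \<subseteq> C" using assms(2,3) by auto
    show "C \<subseteq> ?a ` {1..dynkin_rank t}"
    proof
      fix x assume "x \<in> C"
      then obtain i where "i < length ys" "x = ys ! i" using assms(2) by (metis in_set_conv_nth)
      then show "x \<in> ?a ` {1..dynkin_rank t}" using assms(3) by (intro image_eqI[of _ _ "Suc i"]) auto
    qed
  qed
  fix i j assume ij: "i \<in> {1..dynkin_rank t}" "j \<in> {1..dynkin_rank t}"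
  then have "i - 1 < length ys" "j - 1 < length ys" using assms(3) by auto
  with ij show "2 * (?a i \<bullet> ?a j) / (?a j \<bullet> ?a j) = of_int (cartan_entry t i j)"
    using assms(4)[of "i - 1" "j - 1"] by (simp add: cartan_number_def)
qed

text \<open>Affine B_3 up to orientation: one leaf across a double bond and two further leaves at
  the branch vertex weigh 2/4 + 1/4 + 1/4.\<close>

lemma branch_bond:
  assumes "path xs" "0 < i" "Suc i < length xs" "v \<notin> set xs" "adj (xs ! i) v"
  shows "bond (xs ! i) v = 1"
proof (rule ccontr)
  assume "bond (xs ! i) v \<noteq> 1"
  then have b: "2 \<le> bond (xs ! i) v" using assms(5) by (auto elim: cartan_number_cases)
  have P: "path [xs ! i]" using assms path_nth_C by (intro path_single) auto
  have "adj (xs ! (i - 1)) (xs ! i)" using path_nth_adj[OF assms(1), of "i - 1"] assms by simp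
  then have a: "adj (xs ! i) (xs ! (i - 1))" "adj (xs ! i) (xs ! Suc i)"
    using path_nth_adj[OF assms(1,3)] adj_sym by auto
  have "v \<noteq> xs ! k" if "k < length xs" for k using assms that by auto
  note v = this[of i] this[of "i - 1"] this[of "Suc i"]
  show False
    by (rule no_three_gadgets[OF P _ gadget_leaf[OF P, of "xs ! i" v 2] gadget_leaf_simple[OF P, of "xs ! i" "xs ! (i - 1)"]
          gadget_leaf_simple[OF P, of "xs ! i" "xs ! Suc i"]])
      (use assms a b v in \<open>auto simp: path_nth_eq\<close>)
qed

text \<open>Affine B_n up to orientation. The path from the branch vertex to the near end of the
  multiple bond carries the far end as a leaf of weight 2/4, and two leaves of weight 1/4 at the
  branch vertex.\<close>

lemma branch_simple:
  assumes "path xs" "0 < i" "Suc i < length xs" "v \<notin> set xs" "adj (xs ! i) v"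
    and k: "Suc k < length xs"
  shows "bond (xs ! k) (xs ! Suc k) = 1"
proof (rule ccontr)
  assume "bond (xs ! k) (xs ! Suc k) \<noteq> 1"
  then have b: "2 \<le> bond (xs ! k) (xs ! Suc k)" using path_nth_adj[OF assms(1) k] by (auto elim: cartan_number_cases)
  have v: "v \<noteq> xs ! k" if "k < length xs" for k using assms that by auto
  have ad: "adj (xs ! k) (xs ! Suc k)" by (rule path_nth_adj[OF assms(1) k])
  show False
  proof (cases "i \<le> k")
    \<comment> \<open>The multiple bond lies to the right of the branch vertex, so \<open>v\<close>
      and the left neighbour serve as the two leaves; the other case is its mirror image.\<close>
    case True
    have P: "path (seg xs i k)" using assms True by (intro path_seg) auto
    have "adj (xs ! (i - 1)) (xs ! i)" using path_nth_adj[OF assms(1), of "i - 1"] assms by simp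
    then have a: "adj (xs ! i) (xs ! (i - 1))" by (rule adj_sym)
    show False
      by (rule no_three_gadgets[OF P _ gadget_leaf[OF P, of "xs ! k" "xs ! Suc k" 2] gadget_leaf_simple[OF P, of "xs ! i" v]
          gadget_leaf_simple[OF P, of "xs ! i" "xs ! (i - 1)"]])
        (use assms a ad b v[of "Suc k"] v[of "i - 1"] True in
          \<open>auto simp: path_nth_eq seg_ne nth_seg_iff out_notin_seg\<close>)
  next
    case False
    have P: "path (seg xs (Suc k) i)" using assms False by (intro path_seg) auto
    have a: "adj (xs ! i) (xs ! Suc i)" using path_nth_adj[OF assms(1,3)] .
    show False
      by (rule no_three_gadgets[OF P _ gadget_leaf[OF P, of "xs ! Suc k" "xs ! k" 2] gadget_leaf_simple[OF P, of "xs ! i" v]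
          gadget_leaf_simple[OF P, of "xs ! i" "xs ! Suc i"]])
        (use assms a adj_sym[OF ad] b v[of k] v[of "Suc i"] False bond_sym[of "xs ! k"] in
          \<open>auto simp: path_nth_eq seg_ne nth_seg_iff out_notin_seg\<close>)
  qed
qed

end

section \<open>Classification of the diagrams\<close>

text \<open>The indices are split as 1, 2 and 3 + k, where the third kind numbers an ordinary path:
  root 1 hangs on its first vertex and root 2 on its second.\<close>

lemma cartan_entry_E:
  "cartan_entry (Type_E n) (Suc 0) (Suc 0) = 2"
  "cartan_entry (Type_E n) (Suc 0) (Suc (Suc 0)) = 0"
  "cartan_entry (Type_E n) (Suc (Suc 0)) (Suc 0) = 0"
  "cartan_entry (Type_E n) (Suc (Suc 0)) (Suc (Suc 0)) = 2"
  "cartan_entry (Type_E n) (Suc 0) (Suc (Suc (Suc k))) = (if k = 0 then -1 else 0)"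
  "cartan_entry (Type_E n) (Suc (Suc (Suc k))) (Suc 0) = (if k = 0 then -1 else 0)"
  "cartan_entry (Type_E n) (Suc (Suc 0)) (Suc (Suc (Suc k))) = (if k = 1 then -1 else 0)"
  "cartan_entry (Type_E n) (Suc (Suc (Suc k))) (Suc (Suc 0)) = (if k = 1 then -1 else 0)"
  "cartan_entry (Type_E n) (Suc (Suc (Suc k))) (Suc (Suc (Suc l))) = path_entry k l"
  by (auto simp: path_entry_def doubleton_eq_iff)

text \<open>Connectedness is stated by cuts, so that any proper subdiagram has a neighbour outside.
  In \<open>maximal\<close> the witness can be sought within one component, since the other
  components are orthogonal to \<open>x - y\<close>.\<close>

locale screening_diagram = obtuse_system +
  assumes connected: "X \<subseteq> C \<Longrightarrow> X \<noteq> {} \<Longrightarrow> X \<noteq> C \<Longrightarrow> \<exists>x\<in>X. \<exists>y\<in>C - X. x \<bullet> y \<noteq> 0"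
    and nonempty: "C \<noteq> {}"
    and maximal: "x \<in> C \<Longrightarrow> y \<in> C \<Longrightarrow> x \<noteq> y \<Longrightarrow>
      \<exists>z\<in>C. 2 * (z \<bullet> (x - y)) / ((x - y) \<bullet> (x - y)) \<notin> \<int>"
begin

section \<open>Diagrams with a branch point\<close>

definition longest :: "'a list \<Rightarrow> bool" where
  "longest xs \<longleftrightarrow> path xs \<and> xs \<noteq> [] \<and> (\<forall>ys. path ys \<longrightarrow> length ys \<le> length xs)"

lemma longest_rev: "longest (rev xs) \<longleftrightarrow> longest xs"
  by (simp add: longest_def path_rev)

lemma longestD: "longest xs \<Longrightarrow> path xs"
  by (simp add: longest_def)

lemma longest_exists: "\<exists>xs. longest xs"
proof -
  obtain x where "x \<in> C" using nonempty by blast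
  then have p: "path [x] \<and> [x] \<noteq> []" by (simp add: path_single)
  have "\<forall>ys. path ys \<and> ys \<noteq> [] \<longrightarrow> length ys < Suc (card C)"
    using path_length by (simp add: less_Suc_eq_le)
  from ex_has_greatest_nat[OF p this] obtain xs
    where "path xs" "xs \<noteq> []" "\<And>ys. path ys \<and> ys \<noteq> [] \<Longrightarrow> length ys \<le> length xs" by blast
  then have "longest xs" unfolding longest_def by fastforce
  then show ?thesis ..
qed

text \<open>A vertex attached to either end would lengthen the path.\<close>

lemma attach_inner:
  assumes "longest xs" "i < length xs" "v \<notin> set xs" "adj (xs ! i) v"
  shows "0 < i" "Suc i < length xs"
proof -
  have p: "path xs" "xs \<noteq> []" and l: "\<And>ys. path ys \<Longrightarrow> length ys \<le> length xs"
    using assms by (auto simp: longest_def)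
  have "\<not> path (v # xs)" "\<not> path (v # rev xs)" using l[of "v # xs"] l[of "v # rev xs"] by auto
  then have *: "\<not> adj v (hd xs)" "\<not> adj v (last xs)"
    using path_ConsI[of xs v] path_ConsI[of "rev xs" v] p assms by (auto simp: path_rev hd_rev)
  show "0 < i" using * assms p adj_sym by (metis gr0I hd_conv_nth)
  show "Suc i < length xs" using * assms p adj_sym
    by (metis Suc_lessI last_conv_nth diff_Suc_1)
qed

lemma path_adj_prev: "path xs \<Longrightarrow> 0 < i \<Longrightarrow> i < length xs \<Longrightarrow> adj (xs ! i) (xs ! (i - 1))"
  using path_nth_adj[of xs "i - 1"] adj_sym by simp

lemma attach_unique:
  assumes "path xs" "v \<notin> set xs" "i < length xs" "j < length xs" "adj (xs ! i) v" "adj (xs ! j) v"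
  shows "i = j"
proof -
  have "\<not> i < j" if "i < length xs" "j < length xs" "adj (xs ! i) v" "adj (xs ! j) v" for i j
  proof
    assume ij: "i < j"
    show False
      by (rule no_cycle[of "seg xs i j" v "xs ! i" "xs ! j"])
        (use assms that ij in \<open>auto simp: path_seg path_nth_eq nth_seg_iff out_notin_seg adj_sym\<close>)
  qed
  then show ?thesis using assms by (metis nat_neq_iff)
qed

text \<open>Affine D_n: the segment between the two points of attachment carries \<open>v\<close>,
  \<open>w\<close> and the two path neighbours just outside it, four leaves of weight 1/4. If the
  points coincide this is affine D_4.\<close>

lemma one_branch:
  assumes "longest xs" "i < length xs" "v \<notin> set xs" "adj (xs ! i) v"
    and "j < length xs" "w \<notin> set xs" "adj (xs ! j) w"
  shows "v = w"
proof -
  have *: False if "i \<le> j" "v \<noteq> w" "i < length xs" "v \<notin> set xs" "adj (xs ! i) v"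
    "j < length xs" "w \<notin> set xs" "adj (xs ! j) w" for i j v w
  proof -
    have p: "path xs" by (rule longestD[OF assms(1)])
    have i: "0 < i" "Suc j < length xs" using attach_inner[OF assms(1)] that by blast+
    have P: "path (seg xs i j)" using that p by (intro path_seg) auto
    have ne: "xs ! k \<noteq> v" "xs ! k \<noteq> w" if "k < length xs" for k
      using that \<open>v \<notin> set xs\<close> \<open>w \<notin> set xs\<close> by auto
    have nei: "i - 1 < length xs" using i that by simp
    show False
      by (rule no_four_gadgets[OF P _ gadget_leaf_simple[OF P, of "xs ! i" v] gadget_leaf_simple[OF P, of "xs ! j" w]
            gadget_leaf_simple[OF P, of "xs ! i" "xs ! (i - 1)"] gadget_leaf_simple[OF P, of "xs ! j" "xs ! Suc j"]])
        (use that i p nei ne[of "Suc j"] ne[OF nei] path_nth_adj[OF p, of j] path_adj_prev[OF p, of i] in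
          \<open>auto simp: path_nth_eq seg_ne nth_seg_iff out_notin_seg\<close>)
  qed
  show ?thesis
  proof (cases "i \<le> j")
    case True
    then show ?thesis using *[of i j v w] assms by blast
  next
    case False
    then show ?thesis using *[of j i w v] assms by auto
  qed
qed

text \<open>Affine E_6. A longest path is no shorter than the paths that turn off at the branch
  vertex through \<open>v\<close> and \<open>w\<close>, so it has two vertices on either side; with
  \<open>v\<close>, \<open>w\<close> these are three arms of weight 1/3.\<close>

lemma branch_leaf:
  assumes "longest xs" "i < length xs" "v \<notin> set xs" "adj (xs ! i) v" "w \<notin> set xs"
  shows "\<not> adj v w"
proof
  assume vw: "adj v w"
  have p: "path xs" and l: "\<And>ys. path ys \<Longrightarrow> length ys \<le> length xs"
    using assms by (auto simp: longest_def)
  have wv: "adj w v" "adj v (xs ! i)" using vw assms adj_sym by auto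
  have i: "0 < i" "Suc i < length xs" using attach_inner[OF assms(1-4)] by auto
  have p1: "path (v # seg xs i (length xs - 1))"
    using assms p i wv by (intro path_ConsI) (auto simp: path_seg seg_ne hd_seg out_notin_seg)
  have "path (w # v # seg xs i (length xs - 1))"
    by (rule path_ConsI[OF p1]) (use vw assms i wv in \<open>auto simp: out_notin_seg adj_def\<close>)
  \<comment> \<open>The detour through \<open>v\<close> and \<open>w\<close> replaces the
    \<open>i\<close> vertices before the branch vertex by two.\<close>
  from l[OF this] have i2: "2 \<le> i" using i by (simp add: length_seg)
  have p2: "path (v # rev (seg xs 0 i))"
    using assms p i wv by (intro path_ConsI) (auto simp: path_rev path_seg seg_ne hd_rev last_seg out_notin_seg)
  have "path (w # v # rev (seg xs 0 i))"
    by (rule path_ConsI[OF p2]) (use vw assms i wv in \<open>auto simp: out_notin_seg adj_def\<close>)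
  from l[OF this] have i3: "Suc (Suc i) < length xs" using i by (simp add: length_seg)
  have P: "path [xs ! i]" using p i path_nth_C by (intro path_single) auto
  have A: "path [xs ! (i - 1), xs ! (i - 2)]"
    using path_adj_prev[OF p, of i] path_adj_prev[OF p, of "i - 1"] i i2
    by (auto simp: path_def adj_def numeral_2_eq_2)
  have B: "path [xs ! Suc i, xs ! Suc (Suc i)]"
    using path_nth_adj[OF p i3] by (auto simp: path_def adj_def)
  have D: "path [v, w]" using vw by (auto simp: path_def adj_def)
  have ne: "xs ! k \<noteq> v" "xs ! k \<noteq> w" if "k < length xs" for k
    using that \<open>v \<notin> set xs\<close> \<open>w \<notin> set xs\<close> by auto
  have k: "i - 1 < length xs" "i - 2 < length xs" using i by auto
  show False
    by (rule no_three_gadgets[OF P _ gadget_arm_simple[OF P _ A] gadget_arm_simple[OF P _ B] gadget_arm_simple[OF P _ D]])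
      (use assms i i2 i3 p k ne[OF k(1)] ne[OF k(2)] ne[OF i3] ne[OF i(2)] ne[OF assms(2)]
        path_nth_adj[OF p i(2)] path_adj_prev[OF p, of i] in \<open>auto simp: path_nth_eq\<close>)
qed

text \<open>By connectedness a missing vertex would touch \<open>v\<close> or the path; the first
  contradicts \<open>branch_leaf\<close>, the second \<open>one_branch\<close>.\<close>

lemma branch_all:
  assumes "longest xs" "i < length xs" "v \<notin> set xs" "adj (xs ! i) v"
  shows "C = insert v (set xs)"
proof (rule ccontr)
  assume ne: "C \<noteq> insert v (set xs)"
  have sub: "insert v (set xs) \<subseteq> C" using assms by (auto simp: longest_def path_def adj_def)
  obtain x w where x: "x \<in> insert v (set xs)" "w \<in> C - insert v (set xs)" "x \<bullet> w \<noteq> 0"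
    using connected[OF sub] ne by auto
  then have a: "adj x w" using sub by (auto simp: adj_def)
  show False
  proof (cases "x = v")
    case True
    then show False using branch_leaf[OF assms] a x by auto
  next
    case False
    then obtain j where "j < length xs" "x = xs ! j" using x by (auto simp: in_set_conv_nth)
    then show False using one_branch[OF assms, of j w] a x by auto
  qed
qed

lemma branch_exists:
  assumes "longest xs" "set xs \<noteq> C"
  obtains i v where "i < length xs" "v \<notin> set xs" "adj (xs ! i) v"
proof -
  have "set xs \<subseteq> C" "set xs \<noteq> {}" using assms by (auto simp: longest_def path_def)
  then obtain x v where "x \<in> set xs" "v \<in> C - set xs" "x \<bullet> v \<noteq> 0" using connected assms(2) by blast
  moreover from this have "adj x v" using \<open>set xs \<subseteq> C\<close> by (auto simp: adj_def)
  ultimately show ?thesis using that by (metis DiffD2 in_set_conv_nth)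
qed

text \<open>The difference of two orthogonal simple roots of equal length would be a further screener.\<close>

lemma no_twins:
  assumes "x \<in> C" "y \<in> C" "x \<noteq> y" "x \<bullet> x = N" "y \<bullet> y = N" "x \<bullet> y = 0"
    and "\<And>z. z \<in> C \<Longrightarrow> z \<noteq> x \<Longrightarrow> z \<noteq> y \<Longrightarrow> (z \<bullet> x - z \<bullet> y) / N \<in> \<int>"
  shows False
proof -
  have N: "N > 0" using C_nonzero[OF assms(1)] assms(4) by auto
  have xy: "(x - y) \<bullet> (x - y) = 2 * N" using assms by (simp add: inner_diff_left inner_diff_right inner_commute)
  have "2 * (z \<bullet> (x - y)) / ((x - y) \<bullet> (x - y)) \<in> \<int>" if z: "z \<in> C" for z
  proof -
    have e: "2 * (z \<bullet> (x - y)) / ((x - y) \<bullet> (x - y)) = (z \<bullet> x - z \<bullet> y) / N"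
      unfolding xy inner_diff_right[of z] using N by (simp add: field_simps)
    consider "z = x" | "z = y" | "z \<noteq> x" "z \<noteq> y" by blast
    then show ?thesis
    proof cases
      case 1
      then show ?thesis unfolding e using N assms by simp
    next
      case 2
      then show ?thesis unfolding e using N assms by (simp add: inner_commute)
    next
      case 3
      then show ?thesis unfolding e using assms(7) z by simp
    qed
  qed
  then show False using maximal[OF assms(1-3)] by blast
qed

lemma inner_of_cartan_number: "y \<in> C \<Longrightarrow> x \<bullet> y = cartan_number x y * (y \<bullet> y) / 2"
  using C_nonzero[of y] by (simp add: cartan_number_def)

lemma arm_right:
  assumes "path xs" "0 < k" "i + k < length xs" "0 \<le> w" "w \<le> bond (xs ! i) (xs ! Suc i)"
  shows "gadget [xs ! i] (w * k / (2 * (real k + 1))) ((!) xs ` {Suc i..i + k})"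
proof -
  have "gadget [xs ! i] (w * length (seg xs (Suc i) (i + k)) / (2 * (length (seg xs (Suc i) (i + k)) + 1)))
      (set (seg xs (Suc i) (i + k)))"
    by (rule gadget_arm[of _ "xs ! i"])
      (use assms path_nth_adj[OF assms(1), of i] path_nth_C[OF assms(1)] in
        \<open>auto simp: path_single path_seg seg_ne hd_seg nth_seg_iff\<close>)
  then show ?thesis by (simp add: set_seg length_seg add.commute)
qed

lemma arm_left:
  assumes "path xs" "0 < k" "k \<le> i" "i < length xs"
  shows "gadget [xs ! i] (k / (2 * (real k + 1))) ((!) xs ` {i - k..i - 1})"
proof -
  let ?s = "seg xs (i - k) (i - 1)"
  have "gadget [xs ! i] (real (length (rev ?s)) / real (2 * (length (rev ?s) + 1))) (set (rev ?s))"
    by (rule gadget_arm_simple[of _ "xs ! i"])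
      (use assms path_adj_prev[OF assms(1), of i] path_nth_C[OF assms(1)] in
        \<open>auto simp: path_single path_rev path_seg seg_ne hd_rev last_seg nth_seg_iff\<close>)
  moreover have "length ?s = k" using assms by (simp add: length_seg)
  ultimately show ?thesis by (simp add: set_seg add.commute)
qed

lemma path_norm:
  assumes "path xs" "\<And>k. k < m \<Longrightarrow> bond (xs ! k) (xs ! Suc k) = 1" "m < length xs"
  shows "xs ! m \<bullet> xs ! m = xs ! 0 \<bullet> xs ! 0"
  using assms(2,3)
proof (induction m)
  case (Suc m)
  then show ?case using path_nth_adj[OF assms(1), of m] by (fastforce elim: cartan_number_cases)
qed simp

text \<open>The last hypothesis makes the left arm, of \<open>i\<close> vertices, the shorter one;
  reversing the path achieves this. The third arm is the single vertex \<open>v\<close> of weight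
  1/4, so the two path arms together must weigh less than 3/4.\<close>

lemma branch_type:
  assumes "longest xs" "i < length xs" "v \<notin> set xs" "adj (xs ! i) v" "2 * i + 1 \<le> length xs"
  shows "\<exists>t\<in>maximal_types. has_cartan_type C t"
proof -
  have p: "path xs" by (rule longestD[OF assms(1)])
  have i: "0 < i" "Suc i < length xs" using attach_inner[OF assms(1-4)] by auto
  have b: "bond (xs ! k) (xs ! Suc k) = 1" if "Suc k < length xs" for k
    using branch_simple[OF p i assms(3,4) that] .
  have bv: "bond (xs ! i) v = 1" using branch_bond[OF p i assms(3,4)] .
  have v: "v \<in> C" using assms(4) by (simp add: adj_def)
  have C: "C = insert v (set xs)" using branch_all[OF assms(1-4)] .
  have vx: "xs ! k \<noteq> v" if "k < length xs" for k using that assms(3) by auto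
  have e: "cartan_number (xs ! k) (xs ! l) = of_int (path_entry k l)" if "k < length xs" "l < length xs" for k l
    using path_cartan[OF p that] b by blast
  have ev: "cartan_number (xs ! k) v = (if k = i then -1 else 0)" "cartan_number v (xs ! k) = (if k = i then -1 else 0)"
    if k: "k < length xs" for k
  proof -
    have "\<not> adj (xs ! k) v \<and> \<not> adj v (xs ! k)" if "k \<noteq> i"
      using attach_unique[OF p assms(3) k assms(2) _ assms(4)] adj_sym that by blast
    moreover have "cartan_number (xs ! i) v = -1 \<and> cartan_number v (xs ! i) = -1"
      using assms(4) bv by (auto elim: cartan_number_cases)
    ultimately show "cartan_number (xs ! k) v = (if k = i then -1 else 0)" "cartan_number v (xs ! k) = (if k = i then -1 else 0)"
      using vx[OF k] v path_nth_C[OF p k] cartan_number_nonadj by auto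
  qed
  have P: "path [xs ! i]" using path_nth_C[OF p assms(2)] by (rule path_single)
  have gv: "gadget [xs ! i] (1 / 4) {v}"
    by (rule gadget_leaf_simple[OF P, of "xs ! i"]) (use assms vx in auto)
  have vim: "v \<notin> (!) xs ` {j..k}" if "k < length xs" for j k
    using that vx by (metis atLeastAtMost_iff imageE le_less_trans)
  have arms: "real k / (2 * (real k + 1)) + real l / (2 * (real l + 1)) < 3 / 4"
    if "0 < k" "0 < l" "k \<le> i" "i + l < length xs" for k l
  proof (rule ccontr)
    assume "\<not> real k / (2 * (real k + 1)) + real l / (2 * (real l + 1)) < 3 / 4"
    then have ge: "1 \<le> real k / (2 * (real k + 1)) + real l / (2 * (real l + 1)) + 1 / 4" by linarith
    have d: "(!) xs ` {i - k..i - 1} \<inter> (!) xs ` {Suc i..i + l} = {}"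
      using that path_nth_eq[OF p] by fastforce
    show False
      by (rule no_three_gadgets[OF P _ arm_left[OF p, of k i] arm_right[OF p, of l i 1] gv])
        (use that ge d b[OF i(2)] vim in auto)
  qed
  consider "i = 1" | "i = 2" | "3 \<le> i" using i by linarith
  then show ?thesis
  proof cases
    case 1
    define N where "N = xs ! 0 \<bullet> xs ! 0"
    have n0: "0 < length xs" using i by linarith
    have x1: "xs ! 1 \<bullet> xs ! 1 = N" using path_norm[OF p, of 1] b i 1 by (simp add: N_def)
    have vN: "v \<bullet> v = N" using assms(4) bv x1 1 by (auto elim: cartan_number_cases)
    \<comment> \<open>Type D: the first vertex and \<open>v\<close> are the two ends of the fork.
      They have equal length and every other simple root has the same inner product with
      both.\<close>
    have "False"
    proof (rule no_twins[of "xs ! 0" v N])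
      show "xs ! 0 \<bullet> v = 0" using inner_of_cartan_number[OF v, of "xs ! 0"] ev[OF n0] 1 by simp
      fix z assume z: "z \<in> C" "z \<noteq> xs ! 0" "z \<noteq> v"
      then obtain k where k: "k < length xs" "z = xs ! k" by (auto simp: C in_set_conv_nth)
      with z have "k \<noteq> 0" by metis
      then have "z \<bullet> xs ! 0 = z \<bullet> v"
        using k inner_of_cartan_number[OF v, of z] inner_of_cartan_number[OF path_nth_C[OF p n0], of z] ev[OF k(1)] e[OF k(1) n0]
        by (cases "k = 1") (simp_all add: vN 1 path_entry_def flip: N_def)
      then show "(z \<bullet> xs ! 0 - z \<bullet> v) / N \<in> \<int>" by simp
    qed (use v vx[OF n0] path_nth_C[OF p n0] vN in \<open>auto simp: N_def\<close>)
    then show ?thesis ..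
  next
    case 2
    \<comment> \<open>Affine E_8: arms of 2 and 5 vertices and a leaf weigh 1/3 + 5/12 + 1/4 =
      1.\<close>
    have "\<not> 8 \<le> length xs" using arms[of 2 5] 2 by auto
    then have n: "length xs \<in> {5, 6, 7}" using assms(5) 2 by auto
    obtain x zs where xs: "xs = x # zs" using i by (cases xs) auto
    have ne: "xs \<noteq> []" by (simp add: xs)
    have "has_cartan_type C (Type_E (length xs + 1))"
    \<comment> \<open>Bourbaki's order: the end of the short arm is root 1, \<open>v\<close> is root
      2, and the rest of the path follows from root 3, which makes the branch vertex
      \<open>xs ! 2\<close> root 4.\<close>
    proof (rule has_cartan_typeI[of "x # v # zs"])
      show "distinct (x # v # zs)" using p assms(3) by (auto simp: path_def xs)
      show "set (x # v # zs) = C" by (auto simp: C xs)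
      show "length (x # v # zs) = dynkin_rank (Type_E (length xs + 1))" by (simp add: xs)
      fix k l assume kl: "k < length (x # v # zs)" "l < length (x # v # zs)"
      have x0: "x = xs ! 0" and S: "zs ! m = xs ! Suc m" for m by (auto simp: xs)
      have ks: thesis if "k = 0 \<Longrightarrow> thesis" "k = Suc 0 \<Longrightarrow> thesis"
        "\<And>k'. k = Suc (Suc k') \<Longrightarrow> thesis" for k thesis using that by (metis nat.exhaust)
      have len: "length zs = length xs - 1" by (simp add: xs)
      show "cartan_number ((x # v # zs) ! k) ((x # v # zs) ! l)
          = of_int (cartan_entry (Type_E (length xs + 1)) (Suc k) (Suc l))"
        by (rule ks[of k]; rule ks[of l])
          (use kl 2 in \<open>simp_all only: cartan_entry_E nth_Cons_0 nth_Cons_Suc S x0,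
            simp_all add: len e ev ne cartan_number_self[OF v] less_diff_conv path_entry_def\<close>)
    qed
    moreover have "Type_E (length xs + 1) \<in> maximal_types" using n by (auto simp: maximal_types_def)
    ultimately show ?thesis by blast
  next
    case 3
    \<comment> \<open>Affine E_7: two arms of 3 vertices and a leaf weigh 3/8 + 3/8 + 1/4 =
      1.\<close>
    then show ?thesis using arms[of 3 3] assms(5) by simp
  qed
qed

section \<open>Diagrams that are paths, with at most one multiple bond\<close>

lemma path_typeI:
  assumes "path xs" "set xs = C" "length xs = dynkin_rank t" "Suc k < length xs"
    and "\<And>l. Suc l < length xs \<Longrightarrow> l \<noteq> k \<Longrightarrow> bond (xs ! l) (xs ! Suc l) = 1"
    and "cartan_number (xs ! k) (xs ! Suc k) = of_int (cartan_entry t (Suc k) (Suc (Suc k)))"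
    and "cartan_number (xs ! Suc k) (xs ! k) = of_int (cartan_entry t (Suc (Suc k)) (Suc k))"
    and "\<And>a b. a < length xs \<Longrightarrow> b < length xs \<Longrightarrow> \<not> (a = k \<and> b = Suc k) \<Longrightarrow> \<not> (a = Suc k \<and> b = k) \<Longrightarrow>
      cartan_entry t (Suc a) (Suc b) = path_entry a b"
  shows "has_cartan_type C t"
proof (rule has_cartan_typeI[of xs])
  fix a b assume ab: "a < length xs" "b < length xs"
  show "cartan_number (xs ! a) (xs ! b) = of_int (cartan_entry t (Suc a) (Suc b))"
  proof (cases "a = k \<and> b = Suc k \<or> a = Suc k \<and> b = k")
    case True
    then show ?thesis using assms(6,7) by auto
  next
    case False
    have "cartan_number (xs ! a) (xs ! b) = of_int (path_entry a b)"
      by (rule path_cartan[OF assms(1) ab]) (use False assms(5) in auto)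
    then show ?thesis using assms(8)[OF ab] False by auto
  qed
qed (use assms in \<open>auto simp: path_def\<close>)

lemma bond_vals: "adj x y \<Longrightarrow> bond x y = 1 \<or> bond x y = 2 \<or> bond x y = 3"
  by (auto elim: cartan_number_cases)

text \<open>Affine G_2 up to orientation: 3/4 across the triple bond and 1/4 for any further
  neighbour.\<close>

lemma triple_rank_2:
  assumes "path xs" "Suc k < length xs" "bond (xs ! k) (xs ! Suc k) = 3"
  shows "length xs = 2"
proof (rule ccontr)
  assume "length xs \<noteq> 2"
  then consider "0 < k" | "Suc (Suc k) < length xs" using assms(2) by linarith
  then show False
  proof cases
    case 1
    have P: "path [xs ! k]" using assms path_nth_C by (intro path_single) auto
    have k: "k - 1 < length xs" using assms by auto
    show False
      by (rule no_two_gadgets[OF P _ gadget_leaf[OF P, of "xs ! k" "xs ! Suc k" 3] gadget_leaf_simple[OF P, of "xs ! k" "xs ! (k - 1)"]])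
        (use assms 1 k path_adj_prev[OF assms(1), of k] path_nth_adj[OF assms(1,2)] in \<open>auto simp: path_nth_eq\<close>)
  next
    case 2
    have P: "path [xs ! Suc k]" using assms path_nth_C by (intro path_single) auto
    show False
      by (rule no_two_gadgets[OF P _ gadget_leaf[OF P, of "xs ! Suc k" "xs ! k" 3]
            gadget_leaf_simple[OF P, of "xs ! Suc k" "xs ! Suc (Suc k)"]])
        (use assms 2 adj_sym[OF path_nth_adj[OF assms(1,2)]] path_nth_adj[OF assms(1) 2]
          bond_sym[of "xs ! k"] in \<open>auto simp: path_nth_eq\<close>)
  qed
qed

text \<open>Affine C_n up to orientation: the segment between the two multiple bonds carries a leaf
  of weight 2/4 at each end.\<close>

lemma double_unique:
  assumes "path xs" "k < l" "Suc l < length xs"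
    and "2 \<le> bond (xs ! k) (xs ! Suc k)" "2 \<le> bond (xs ! l) (xs ! Suc l)"
  shows False
proof -
  have P: "path (seg xs (Suc k) l)" using assms by (intro path_seg) auto
  have k: "Suc k < length xs" using assms by simp
  show False
    by (rule no_two_gadgets[OF P _ gadget_leaf[OF P, of "xs ! Suc k" "xs ! k" 2] gadget_leaf[OF P, of "xs ! l" "xs ! Suc l" 2]])
      (use assms adj_sym[OF path_nth_adj[OF assms(1) k]] path_nth_adj[OF assms(1,3)]
          bond_sym[of "xs ! k"] in \<open>auto simp: path_nth_eq seg_ne nth_seg_iff\<close>)
qed

lemma simple_path_type:
  assumes "path xs" "set xs = C" "\<And>k. Suc k < length xs \<Longrightarrow> bond (xs ! k) (xs ! Suc k) = 1"
  shows "\<exists>t\<in>maximal_types. has_cartan_type C t"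
proof -
  define N where "N = xs ! 0 \<bullet> xs ! 0"
  have N: "xs ! k \<bullet> xs ! k = N" if "k < length xs" for k
    unfolding N_def using that assms(3) by (intro path_norm[OF assms(1)]) auto
  have xC: "xs ! k \<in> C" if "k < length xs" for k using path_nth_C[OF assms(1) that] .
  have e: "cartan_number (xs ! k) (xs ! l) = of_int (path_entry k l)" if "k < length xs" "l < length xs" for k l
    using path_cartan[OF assms(1) that] assms(3) by blast
  have inn: "xs ! k \<bullet> xs ! l = of_int (path_entry k l) * N / 2" if "k < length xs" "l < length xs" for k l
    using inner_of_cartan_number[OF xC[OF that(2)], of "xs ! k"] e[OF that] N[OF that(2)] by simp
  have A: "has_cartan_type C (Type_A (length xs))"
    by (rule has_cartan_typeI[of xs]) (use assms e in \<open>auto simp: path_def\<close>)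
  have C: "z \<in> C \<longleftrightarrow> (\<exists>k<length xs. z = xs ! k)" for z using assms(2) by (auto simp: in_set_conv_nth)
  consider "length xs = 1" | "length xs = 2" | "length xs = 3" | "4 \<le> length xs"
    using nonempty assms(2) by (cases "length xs") fastforce+
  then show ?thesis
  proof cases
    case 1
    then have "Type_A (length xs) \<in> maximal_types" by (simp add: maximal_types_def)
    then show ?thesis using A by blast
  next
    case 2
    have i: "xs ! 0 \<bullet> xs ! 0 = N" "xs ! 1 \<bullet> xs ! 1 = N" "xs ! 0 \<bullet> xs ! 1 = - N / 2" "xs ! 1 \<bullet> xs ! 0 = - N / 2"
      using inn[of 0 1] inn[of 1 0] N[of 0] N[of 1] 2 by (auto simp: path_entry_def)
    have N0: "N \<noteq> 0" using C_nonzero[OF xC, of 0] 2 by (simp add: N_def)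
    have ne: "xs ! 0 \<noteq> xs ! 1" using path_nth_eq[OF assms(1), of 0 1] 2 by simp
    \<comment> \<open>In A_2 the difference of the simple roots has three times their norm, as a
      long root of G_2 has, and its Cartan numbers with them are 1 and -1.\<close>
    have d: "(xs ! 0 - xs ! 1) \<bullet> (xs ! 0 - xs ! 1) = 3 * N"
      by (simp add: inner_diff_left inner_diff_right i[simplified])
    obtain z where z: "z \<in> C" "2 * (z \<bullet> (xs ! 0 - xs ! 1)) / (3 * N) \<notin> \<int>"
      using maximal[OF xC xC ne] 2 unfolding d by auto
    then have "z = xs ! 0 \<or> z = xs ! 1" using 2 by (auto simp: C less_2_cases_iff)
    then have "2 * (z \<bullet> (xs ! 0 - xs ! 1)) / (3 * N) \<in> {1, -1}"
      using N0 by (auto simp: inner_diff_right i[simplified] field_simps)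
    then have "2 * (z \<bullet> (xs ! 0 - xs ! 1)) / (3 * N) \<in> \<int>" by (elim insertE) auto
    then show ?thesis using z by blast
  next
    case 3
    \<comment> \<open>The ends of A_3 have the same inner product with the middle root, the only
      other one.\<close>
    have False
    proof (rule no_twins[of "xs ! 0" "xs ! 2" N])
      fix z assume "z \<in> C" "z \<noteq> xs ! 0" "z \<noteq> xs ! 2"
      then have "z = xs ! 1" using 3 by (auto simp: C less_Suc_eq numeral_3_eq_3 numeral_2_eq_2)
      then show "(z \<bullet> xs ! 0 - z \<bullet> xs ! 2) / N \<in> \<int>" using inn[of 1 0] inn[of 1 2] 3 by (simp add: path_entry_def)
    qed (use 3 xC N inn[of 0 2] path_nth_eq[OF assms(1), of 0 2] in \<open>auto simp: path_entry_def\<close>)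
    then show ?thesis ..
  next
    case 4
    then have "Type_A (length xs) \<in> maximal_types" by (simp add: maximal_types_def)
    then show ?thesis using A by blast
  qed
qed

text \<open>The long root has inner product -N with root 3, where a short neighbour would give -N/2;
  its Cartan number with the difference of roots 1 and 3 is therefore the integer 1. Root 2 meets
  roots 1 and 3 equally.\<close>

lemma no_C4:
  assumes "path xs" "set xs = C" "length xs = 4"
    and "bond (xs ! 0) (xs ! 1) = 1" "bond (xs ! 1) (xs ! 2) = 1" "cartan_number (xs ! 3) (xs ! 2) = -2"
  shows False
proof -
  define N where "N = xs ! 0 \<bullet> xs ! 0"
  have s: "bond (xs ! k) (xs ! Suc k) = 1" if "k < 2" for k
  proof -
    have "k = 0 \<or> k = 1" using that by linarith
    then show ?thesis using assms(4,5) by (auto simp: numeral_2_eq_2)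
  qed
  have N: "xs ! k \<bullet> xs ! k = N" if "k < 3" for k
    unfolding N_def using that assms(3) s by (intro path_norm[OF assms(1)]) auto
  have xC: "xs ! k \<in> C" if "k < 4" for k using path_nth_C[OF assms(1)] that assms(3) by simp
  have inn: "xs ! k \<bullet> xs ! l = of_int (path_entry k l) * N / 2"
    if "k < 4" "l < 3" "k = 3 \<longrightarrow> l \<noteq> 2" for k l
  proof -
    have "cartan_number (xs ! k) (xs ! l) = of_int (path_entry k l)"
      by (rule path_cartan[OF assms(1)]) (use that assms(3) s in auto)
    then show ?thesis using inner_of_cartan_number[OF xC, of l "xs ! k"] N[OF that(2)] that by simp
  qed
  have i3: "xs ! 3 \<bullet> xs ! 2 = - N" using inner_of_cartan_number[OF xC, of 2 "xs ! 3"] N[of 2] assms(6) by simp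
  have N0: "N \<noteq> 0" using C_nonzero[OF xC, of 0] by (simp add: N_def)
  have C: "z \<in> C \<longleftrightarrow> (\<exists>k<4. z = xs ! k)" for z using assms(2,3) by (auto simp: in_set_conv_nth)
  show False
  proof (rule no_twins[of "xs ! 0" "xs ! 2" N])
    fix z assume "z \<in> C" "z \<noteq> xs ! 0" "z \<noteq> xs ! 2"
    then obtain k where "k < 4" "k \<noteq> 0" "k \<noteq> 2" "z = xs ! k" unfolding C by metis
    moreover from this have "k = 1 \<or> k = 3" by linarith
    ultimately have "z = xs ! 1 \<or> z = xs ! 3" by blast
    then show "(z \<bullet> xs ! 0 - z \<bullet> xs ! 2) / N \<in> \<int>"
      using inn[of 1 0] inn[of 1 2] inn[of 3 0] i3 N0 by (auto simp: path_entry_def)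
  qed (use xC N inn[of 0 2] path_nth_eq[OF assms(1), of 0 2] assms(3) in \<open>auto simp: path_entry_def\<close>)
qed

text \<open>The last hypothesis says that at least as many vertices precede the double bond as
  follow it. At the end of the path the bond gives B or C according to which side is longer;
  otherwise only F_4 remains.\<close>

lemma double_path_type:
  assumes "path xs" "set xs = C" "Suc k < length xs" "bond (xs ! k) (xs ! Suc k) = 2"
    and "length xs \<le> 2 * k + 2"
  shows "\<exists>t\<in>maximal_types. has_cartan_type C t"
proof -
  have one: "bond (xs ! l) (xs ! Suc l) = 1" if "Suc l < length xs" "l \<noteq> k" for l
  proof -
    have "\<not> 2 \<le> bond (xs ! l) (xs ! Suc l)"
      using double_unique[OF assms(1), of l k] double_unique[OF assms(1), of k l] that assms(3,4)
      by (metis nat_neq_iff order_refl)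
    then show ?thesis using bond_vals[OF path_nth_adj[OF assms(1) that(1)]] by auto
  qed
  have ad: "adj (xs ! k) (xs ! Suc k)" by (rule path_nth_adj[OF assms(1,3)])
  have c: "cartan_number (xs ! k) (xs ! Suc k) = -1 \<and> cartan_number (xs ! Suc k) (xs ! k) = -2 \<or>
      cartan_number (xs ! k) (xs ! Suc k) = -2 \<and> cartan_number (xs ! Suc k) (xs ! k) = -1"
    using ad assms(4) by (auto elim: cartan_number_cases)
  have pr: "path (rev xs)" "set (rev xs) = C" using assms by (auto simp: path_rev)
  show ?thesis
  proof (cases "length xs = k + 2")
    case len: True
    from c show ?thesis
    proof
      assume c: "cartan_number (xs ! k) (xs ! Suc k) = -1 \<and> cartan_number (xs ! Suc k) (xs ! k) = -2"
      \<comment> \<open>The last root is the long one, so the type is C of rank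
        \<open>k + 2\<close>. In rank 2 this is B_2 read backwards, and rank 4 is excluded.\<close>
      consider "k = 0" | "k = 2" | "k \<noteq> 0" "k \<noteq> 2" by blast
      then show ?thesis
      proof cases
        case 1
        have "has_cartan_type C (Type_B 2)"
          by (rule path_typeI[OF pr, of _ 0])
            (use 1 len c in \<open>auto simp: rev_nth path_entry_def\<close>)
        then show ?thesis by (auto simp: maximal_types_def)
      next
        case 2
        have False by (rule no_C4[OF assms(1,2)])
          (use 2 len c one[of 0] one[of 1] in \<open>auto simp: numeral_2_eq_2 numeral_3_eq_3\<close>)
        then show ?thesis ..
      next
        case 3
        have "has_cartan_type C (Type_C (k + 2))"
          by (rule path_typeI[OF assms(1,2), of _ k])
            (use 3 len c one in \<open>auto simp: path_entry_def\<close>)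
        moreover have "Type_C (k + 2) \<in> maximal_types" using 3 by (auto simp: maximal_types_def)
        ultimately show ?thesis by blast
      qed
    next
      assume c: "cartan_number (xs ! k) (xs ! Suc k) = -2 \<and> cartan_number (xs ! Suc k) (xs ! k) = -1"
      have "has_cartan_type C (Type_B (k + 2))"
        by (rule path_typeI[OF assms(1,2), of _ k])
          (use len c one in \<open>auto simp: path_entry_def\<close>)
      moreover have "Type_B (k + 2) \<in> maximal_types"
      proof -
        have "k + 2 \<in> {2, 3, 4} \<or> k + 2 > 4" by auto
        then show ?thesis unfolding maximal_types_def by blast
      qed
      ultimately show ?thesis by blast
    qed
  next
    case False
    then have k: "1 \<le> k" "k + 2 < length xs" using assms(3,5) by auto
    \<comment> \<open>Affine F_4 up to orientation: two vertices on the left weigh 1/3, two on the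
      right, joined by the double bond, weigh 2/3.\<close>
    have "k < 2"
    proof (rule ccontr)
      assume k2: "\<not> k < 2"
      have P: "path [xs ! k]" using path_nth_C[OF assms(1)] k by (intro path_single) auto
      have d: "(!) xs ` {k - 2..k - 1} \<inter> (!) xs ` {Suc k..k + 2} = {}"
        using k path_nth_eq[OF assms(1)] by fastforce
      show False
        by (rule no_two_gadgets[OF P _ arm_left[OF assms(1), of 2 k] arm_right[OF assms(1), of 2 k 2]])
          (use k k2 d assms(4) in auto)
    qed
    then have k1: "k = 1" "length xs = 4" using k assms(5) by auto
    from c have "has_cartan_type C Type_F4"
    proof
      assume c: "cartan_number (xs ! k) (xs ! Suc k) = -1 \<and> cartan_number (xs ! Suc k) (xs ! k) = -2"
      have o: "bond (rev xs ! l) (rev xs ! Suc l) = 1" if "Suc l < length (rev xs)" "l \<noteq> 1" for l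
      proof -
        have "l = 0 \<or> l = 2" using that k1 by auto
        then show ?thesis using one[of 0] one[of 2] bond_sym[of "xs ! 0"] bond_sym[of "xs ! 2"] k1
          by (auto simp: rev_nth numeral_2_eq_2 numeral_3_eq_3)
      qed
      show ?thesis
        by (rule path_typeI[OF pr, of _ 1])
          (use c o k1 in \<open>auto simp: rev_nth path_entry_def numeral_2_eq_2\<close>)
    next
      assume c: "cartan_number (xs ! k) (xs ! Suc k) = -2 \<and> cartan_number (xs ! Suc k) (xs ! k) = -1"
      show ?thesis
        by (rule path_typeI[OF assms(1,2), of _ 1])
          (use c one k1 in \<open>auto simp: path_entry_def\<close>)
    qed
    then show ?thesis by (auto simp: maximal_types_def)
  qed
qed

lemma path_type:
  assumes "path xs" "set xs = C"
  shows "\<exists>t\<in>maximal_types. has_cartan_type C t"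
proof (cases "\<forall>k. Suc k < length xs \<longrightarrow> bond (xs ! k) (xs ! Suc k) = 1")
  case True
  then show ?thesis using simple_path_type assms by blast
next
  case False
  then obtain k where k: "Suc k < length xs" "bond (xs ! k) (xs ! Suc k) \<noteq> 1" by blast
  have ad: "adj (xs ! k) (xs ! Suc k)" by (rule path_nth_adj[OF assms(1) k(1)])
  have pr: "path (rev xs)" "set (rev xs) = C" using assms by (auto simp: path_rev)
  from bond_vals[OF ad] k(2) consider "bond (xs ! k) (xs ! Suc k) = 2" | "bond (xs ! k) (xs ! Suc k) = 3" by blast
  then show ?thesis
  proof cases
    case 1
    show ?thesis
    proof (cases "length xs \<le> 2 * k + 2")
      case True
      then show ?thesis using double_path_type[OF assms k(1) 1] by blast
    next
      case False
      \<comment> \<open>The position of the same edge in the reversed path.\<close>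
      define l where "l = length xs - 2 - k"
      have "Suc l < length (rev xs)" "length (rev xs) \<le> 2 * l + 2"
        "rev xs ! l = xs ! Suc k" "rev xs ! Suc l = xs ! k"
        using False k(1) by (auto simp: l_def rev_nth intro!: arg_cong[of _ _ "(!) xs"])
      then show ?thesis using double_path_type[OF pr, of l] 1 bond_sym[of "xs ! k"] by simp
    qed
  next
    case 2
    have n: "length xs = 2" by (rule triple_rank_2[OF assms(1) k(1) 2])
    have k0: "k = 0" using n k by simp
    have "cartan_number (xs ! 0) (xs ! 1) = -1 \<and> cartan_number (xs ! 1) (xs ! 0) = -3 \<or>
      cartan_number (xs ! 0) (xs ! 1) = -3 \<and> cartan_number (xs ! 1) (xs ! 0) = -1"
      using ad 2 k0 by (auto elim: cartan_number_cases)
    then have "has_cartan_type C Type_G2"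
    proof
      assume c: "cartan_number (xs ! 0) (xs ! 1) = -1 \<and> cartan_number (xs ! 1) (xs ! 0) = -3"
      show ?thesis
        by (rule path_typeI[OF assms, of _ 0]) (use c n in \<open>auto simp: path_entry_def\<close>)
    next
      assume c: "cartan_number (xs ! 0) (xs ! 1) = -3 \<and> cartan_number (xs ! 1) (xs ! 0) = -1"
      show ?thesis
        by (rule path_typeI[OF pr, of _ 0]) (use c n in \<open>auto simp: path_entry_def rev_nth\<close>)
    qed
    then show ?thesis by (auto simp: maximal_types_def)
  qed
qed

theorem diagram_type: "\<exists>t\<in>maximal_types. has_cartan_type C t"
proof -
  obtain xs where xs: "longest xs" using longest_exists by blast
  show ?thesis
  proof (cases "set xs = C")
    case True
    then show ?thesis using path_type longestD[OF xs] by blast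
  next
    case False
    obtain i v where v: "i < length xs" "v \<notin> set xs" "adj (xs ! i) v"
      using branch_exists[OF xs False] .
    show ?thesis
    proof (cases "2 * i + 1 \<le> length xs")
      case True
      then show ?thesis using branch_type[OF xs v] by blast
    next
      case False
      have "rev xs ! (length xs - Suc i) = xs ! i" using v(1) by (simp add: rev_nth)
      then show ?thesis
        using branch_type[of "rev xs" "length xs - Suc i" v] xs v False by (simp add: longest_rev)
    qed
  qed
qed

end

section \<open>Bases of root systems\<close>

lemma reflection_self: "root_reflection \<alpha> \<alpha> = - \<alpha>"
  by (cases "\<alpha> = 0") (simp_all add: root_reflection_def scaleR_2)

lemma reflection_involution: "root_reflection \<alpha> (root_reflection \<alpha> x) = x"
  by (cases "\<alpha> = 0")
    (simp_all add: root_reflection_def inner_diff_left algebra_simps)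

lemma reflection_inner:
  "root_reflection \<alpha> x \<bullet> y = x \<bullet> root_reflection \<alpha> y"
  by (simp add: root_reflection_def inner_diff_left inner_diff_right inner_commute)

lemma reflection_isometry: "root_reflection \<alpha> x \<bullet> root_reflection \<alpha> y = x \<bullet> y"
  by (simp add: reflection_inner reflection_involution)

lemma reflection_scale: "root_reflection \<alpha> (c *\<^sub>R x) = c *\<^sub>R root_reflection \<alpha> x"
  by (simp add: root_reflection_def algebra_simps)

lemma reflection_image:
  assumes "\<And>x. x \<in> X \<Longrightarrow> root_reflection \<alpha> x \<in> X" shows "root_reflection \<alpha> ` X = X"
  using assms reflection_involution by (metis image_subset_iff subsetI subset_antisym image_eqI)

text \<open>Finitely many hyperplanes form a null set and so cannot cover the space.\<close>

lemma generic_functional: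
  fixes R :: "'a::euclidean_space set"
  assumes "finite R" "0 \<notin> R" obtains h where "\<And>\<alpha>. \<alpha> \<in> R \<Longrightarrow> h \<bullet> \<alpha> \<noteq> 0"
proof -
  have "negligible (\<Union>\<alpha>\<in>R. {x. \<alpha> \<bullet> x = 0})"
    using assms by (intro negligible_Union) (auto intro!: negligible_hyperplane)
  then have "(\<Union>\<alpha>\<in>R. {x. \<alpha> \<bullet> x = 0}) \<noteq> UNIV" by (metis non_negligible_UNIV)
  then obtain h where "h \<notin> (\<Union>\<alpha>\<in>R. {x. \<alpha> \<bullet> x = 0})" by blast
  then show ?thesis using that[of h] by (auto simp: inner_commute)
qed

lemma independent_coeff_unique:
  fixes D :: "'a::real_vector set"
  assumes "independent D" "finite D" "(\<Sum>\<delta>\<in>D. f \<delta> *\<^sub>R \<delta>) = (\<Sum>\<delta>\<in>D. g \<delta> *\<^sub>R \<delta>)" "\<delta> \<in> D"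
  shows "f \<delta> = g \<delta>"
proof -
  have "(\<Sum>\<delta>\<in>D. (f \<delta> - g \<delta>) *\<^sub>R \<delta>) = 0" using assms(3) by (simp add: scaleR_diff_left sum_subtractf)
  then have "f \<delta> - g \<delta> \<noteq> 0 \<Longrightarrow> dependent D" unfolding dependent_finite[OF assms(2)]
    using assms(4) by (intro exI[of _ "\<lambda>\<delta>. f \<delta> - g \<delta>"]) auto
  then show ?thesis using assms(1) by auto
qed

locale generic_root_system =
  fixes R :: "'a::euclidean_space set" and h :: 'a
  assumes root_sys: "root_system R" and generic: "\<alpha> \<in> R \<Longrightarrow> h \<bullet> \<alpha> \<noteq> 0"
begin

definition pos_roots :: "'a set" where "pos_roots = {\<alpha> \<in> R. 0 < h \<bullet> \<alpha>}"

definition simples :: "'a set" where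
  "simples = {\<alpha> \<in> pos_roots. \<forall>\<beta>\<in>pos_roots. \<alpha> - \<beta> \<notin> pos_roots}"

lemma finite_R: "finite R" and nonzero: "\<alpha> \<in> R \<Longrightarrow> \<alpha> \<noteq> 0"
  and refl_mem: "\<alpha> \<in> R \<Longrightarrow> \<beta> \<in> R \<Longrightarrow> root_reflection \<alpha> \<beta> \<in> R"
  and cartan: "\<alpha> \<in> R \<Longrightarrow> \<beta> \<in> R \<Longrightarrow> 2 * (\<beta> \<bullet> \<alpha>) / (\<alpha> \<bullet> \<alpha>) \<in> \<int>"
  using root_sys unfolding root_system_def by blast+

lemma neg_root: "\<alpha> \<in> R \<Longrightarrow> - \<alpha> \<in> R"
  using refl_mem[of \<alpha> \<alpha>] by (simp add: reflection_self)

lemma simples_R: "simples \<subseteq> R" and simples_pos: "\<alpha> \<in> simples \<Longrightarrow> 0 < h \<bullet> \<alpha>"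
  by (auto simp: simples_def pos_roots_def)

lemma finite_simples: "finite simples"
  using simples_R finite_R finite_subset by blast

text \<open>Both Cartan numbers are positive integers. If one of them is 1, a reflection yields the
  difference up to sign; if both are at least 2, the difference has square at most 0.\<close>

lemma diff_root:
  assumes "\<alpha> \<in> R" "\<beta> \<in> R" "0 < \<alpha> \<bullet> \<beta>" "\<alpha> \<noteq> \<beta>" shows "\<alpha> - \<beta> \<in> R"
proof -
  have p: "0 < \<alpha> \<bullet> \<alpha>" "0 < \<beta> \<bullet> \<beta>" using assms nonzero by auto
  obtain m n :: int where mn: "2 * (\<alpha> \<bullet> \<beta>) / (\<beta> \<bullet> \<beta>) = of_int m" "2 * (\<alpha> \<bullet> \<beta>) / (\<alpha> \<bullet> \<alpha>) = of_int n"
    using cartan[OF assms(2,1)] cartan[OF assms(1,2)] by (auto elim!: Ints_cases simp: inner_commute)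
  have "0 < real_of_int m" "0 < real_of_int n" unfolding mn[symmetric] using assms p by simp_all
  then have mn0: "0 < m" "0 < n" by simp_all
  show ?thesis
  proof (cases "m = 1 \<or> n = 1")
    case True
    then show ?thesis
    proof
      assume "m = 1"
      then have "root_reflection \<beta> \<alpha> = \<alpha> - \<beta>" by (simp only: root_reflection_def mn) simp
      then show ?thesis using refl_mem assms by metis
    next
      assume "n = 1"
      then have "root_reflection \<alpha> \<beta> = \<beta> - \<alpha>" 
        by (simp only: root_reflection_def inner_commute[of \<beta> \<alpha>] mn) simp
      then show ?thesis using refl_mem[OF assms(1,2)] neg_root[of "\<beta> - \<alpha>"] by simp
    qed
  next
    case False
    then have ge: "2 \<le> real_of_int m" "2 \<le> real_of_int n" using mn0 by linarith+
    have "2 * (\<beta> \<bullet> \<beta>) \<le> 2 * (\<alpha> \<bullet> \<beta>)" "2 * (\<alpha> \<bullet> \<alpha>) \<le> 2 * (\<alpha> \<bullet> \<beta>)"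
      using ge p unfolding mn[symmetric] by (simp_all add: pos_le_divide_eq)
    then have "(\<alpha> - \<beta>) \<bullet> (\<alpha> - \<beta>) \<le> 0"
      by (simp add: inner_diff_left inner_diff_right inner_commute)
    then show ?thesis using assms(4) by (metis inner_ge_zero inner_eq_zero_iff order_antisym right_minus_eq)
  qed
qed

text \<open>At an acute angle the difference is a root, and whichever of \<open>x - y\<close> and
  \<open>y - x\<close> is positive decomposes \<open>x\<close> or \<open>y\<close>.\<close>

lemma simples_obtuse:
  assumes "x \<in> simples" "y \<in> simples" "x \<noteq> y" shows "x \<bullet> y \<le> 0"
proof (rule ccontr)
  assume "\<not> x \<bullet> y \<le> 0"
  then have d: "x - y \<in> R" using diff_root assms simples_R by (meson not_le subsetD)
  then have "y - x \<in> R" using neg_root by fastforce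
  moreover have "0 < h \<bullet> (x - y) \<or> 0 < h \<bullet> (y - x)"
    using generic[OF d] by (auto simp: inner_diff_right)
  ultimately have "x - y \<in> pos_roots \<or> y - x \<in> pos_roots" using d by (auto simp: pos_roots_def)
  then show False using assms by (auto simp: simples_def)
qed

text \<open>Moving the non-positive coefficients to the other side of a relation gives
  \<open>p = q\<close> with \<open>p\<close> and \<open>q\<close> at an obtuse angle, so both
  vanish; positivity of \<open>h\<close> on simple roots then kills every coefficient.\<close>

lemma independent_simples: "independent simples"
proof
  assume "dependent simples"
  then obtain u where u: "\<exists>v\<in>simples. u v \<noteq> 0" "(\<Sum>v\<in>simples. u v *\<^sub>R v) = 0"
    using dependent_finite[OF finite_simples] by auto
  define P where "P = {v \<in> simples. 0 < u v}"
  define N where "N = simples - P"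
  have fin: "finite P" "finite N" and sub: "P \<subseteq> simples" "N \<subseteq> simples" "P \<inter> N = {}"
    using finite_simples by (auto simp: P_def N_def)
  define p where "p = (\<Sum>v\<in>P. u v *\<^sub>R v)"
  define q where "q = (\<Sum>v\<in>N. (- u v) *\<^sub>R v)"
  have "(\<Sum>v\<in>simples. u v *\<^sub>R v) = p - q" unfolding p_def q_def N_def
    using sum.subset_diff[OF sub(1) finite_simples, of "\<lambda>v. u v *\<^sub>R v"] by (simp add: sum_negf)
  then have pq: "p = q" using u by simp
  have "p \<bullet> q = (\<Sum>v\<in>P. \<Sum>w\<in>N. (u v * - u w) * (v \<bullet> w))"
    unfolding p_def q_def inner_sum_left inner_sum_right
    by (subst sum.swap) (simp add: mult_ac)
  also have "\<dots> \<le> 0"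
  proof (intro sum_nonpos)
    fix v w assume "v \<in> P" "w \<in> N"
    then have "0 \<le> u v * - u w" "v \<bullet> w \<le> 0" using sub
      by (auto simp: P_def N_def intro!: simples_obtuse mult_nonneg_nonpos)
    then show "(u v * - u w) * (v \<bullet> w) \<le> 0" by (rule mult_nonneg_nonpos)
  qed
  finally have "p \<bullet> p \<le> 0" using pq by simp
  then have p0: "p = 0" "q = 0" using pq by (metis inner_ge_zero inner_eq_zero_iff order_antisym)+
  have "u v = 0" if v: "v \<in> simples" for v
  proof (cases "v \<in> P")
    case True
    have "(\<Sum>v\<in>P. u v * (h \<bullet> v)) = 0" using p0(1) unfolding p_def
      by (metis (no_types, lifting) inner_scaleR_right inner_sum_right inner_zero_right sum.cong)
    moreover have "\<And>v. v \<in> P \<Longrightarrow> 0 < u v * (h \<bullet> v)" using simples_pos by (auto simp: P_def)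
    ultimately show ?thesis using True sum_pos[OF fin(1), of "\<lambda>v. u v * (h \<bullet> v)"] by auto
  next
    case False
    then have vN: "v \<in> N" using v by (simp add: N_def)
    have "(\<Sum>v\<in>N. - u v * (h \<bullet> v)) = 0" using p0(2) unfolding q_def
      by (metis (no_types, lifting) inner_scaleR_right inner_sum_right inner_zero_right sum.cong)
    moreover have "\<And>v. v \<in> N \<Longrightarrow> 0 \<le> - u v * (h \<bullet> v)"
      using simples_pos sub by (intro mult_nonneg_nonneg) (auto simp: P_def N_def less_imp_le)
    ultimately have "- u v * (h \<bullet> v) = 0"
      using vN sum_nonneg_eq_0_iff[OF fin(2), of "\<lambda>v. - u v * (h \<bullet> v)"] by blast
    then show ?thesis using simples_pos[OF v] by simp
  qed
  then show False using u by blast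
qed

lemmas simples_unique = independent_coeff_unique[OF independent_simples finite_simples]

text \<open>The values of \<open>h\<close> are real, so the induction runs over the number of
  positive roots with a smaller value.\<close>

lemma pos_root_induct [consumes 1, case_names simple sum]:
  assumes "\<alpha> \<in> pos_roots" and simple: "\<And>\<alpha>. \<alpha> \<in> simples \<Longrightarrow> P \<alpha>"
    and sum: "\<And>\<alpha> \<beta>. \<alpha> \<in> pos_roots \<Longrightarrow> \<beta> \<in> pos_roots \<Longrightarrow> \<alpha> + \<beta> \<in> pos_roots \<Longrightarrow> P \<alpha> \<Longrightarrow> P \<beta> \<Longrightarrow> P (\<alpha> + \<beta>)"
  shows "P \<alpha>"
  using assms(1)
proof (induction "card {\<beta> \<in> pos_roots. h \<bullet> \<beta> < h \<bullet> \<alpha>}" arbitrary: \<alpha> rule: less_induct)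
  case less
  show ?case
  proof (cases "\<alpha> \<in> simples")
    case False
    then obtain \<beta> where b: "\<beta> \<in> pos_roots" "\<alpha> - \<beta> \<in> pos_roots" using less.prems by (auto simp: simples_def)
    have fin: "finite pos_roots" using finite_R by (simp add: pos_roots_def)
    have *: "P \<gamma>" if g: "\<gamma> \<in> pos_roots" "h \<bullet> \<gamma> < h \<bullet> \<alpha>" for \<gamma>
    proof (rule less.hyps[OF _ g(1)])
      have "{\<beta> \<in> pos_roots. h \<bullet> \<beta> < h \<bullet> \<gamma>} \<subset> {\<beta> \<in> pos_roots. h \<bullet> \<beta> < h \<bullet> \<alpha>}" using g by auto
      then show "card {\<beta> \<in> pos_roots. h \<bullet> \<beta> < h \<bullet> \<gamma>} < card {\<beta> \<in> pos_roots. h \<bullet> \<beta> < h \<bullet> \<alpha>}"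
        using fin by (intro psubset_card_mono) auto
    qed
    have "P \<beta>" "P (\<alpha> - \<beta>)" using b by (auto intro!: * simp: pos_roots_def inner_diff_right)
    then show ?thesis using sum[OF b] less.prems by simp
  qed (rule simple)
qed

lemma pos_root_coeffs:
  "\<alpha> \<in> pos_roots \<Longrightarrow> \<exists>k::'a \<Rightarrow> nat. \<alpha> = (\<Sum>\<delta>\<in>simples. real (k \<delta>) *\<^sub>R \<delta>)"
proof (induction rule: pos_root_induct)
  case (simple \<alpha>)
  have "(\<Sum>\<delta>\<in>simples. real (if \<delta> = \<alpha> then 1 else 0) *\<^sub>R \<delta>) = (\<Sum>\<delta>\<in>simples. if \<delta> = \<alpha> then \<alpha> else 0)"
    by (intro sum.cong) auto
  also have "\<dots> = \<alpha>" using simple finite_simples by simp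
  finally show ?case by metis
next
  case (sum \<alpha> \<beta>)
  then obtain k l :: "'a \<Rightarrow> nat" where "\<alpha> = (\<Sum>\<delta>\<in>simples. real (k \<delta>) *\<^sub>R \<delta>)" "\<beta> = (\<Sum>\<delta>\<in>simples. real (l \<delta>) *\<^sub>R \<delta>)"
    by blast
  then have "\<alpha> + \<beta> = (\<Sum>\<delta>\<in>simples. real (k \<delta> + l \<delta>) *\<^sub>R \<delta>)"
    by (simp add: scaleR_add_left sum.distrib)
  then show ?case by (intro exI[of _ "\<lambda>\<delta>. k \<delta> + l \<delta>"])
qed

lemma pos_or_neg: "\<alpha> \<in> R \<Longrightarrow> \<alpha> \<in> pos_roots \<or> - \<alpha> \<in> pos_roots"
  using generic[of \<alpha>] neg_root by (auto simp: pos_roots_def)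

lemma root_coeffs:
  assumes "\<alpha> \<in> R"
  shows "\<exists>k::'a \<Rightarrow> nat. \<alpha> = (\<Sum>\<delta>\<in>simples. real (k \<delta>) *\<^sub>R \<delta>) \<or> \<alpha> = - (\<Sum>\<delta>\<in>simples. real (k \<delta>) *\<^sub>R \<delta>)"
  using pos_or_neg[OF assms] pos_root_coeffs[of \<alpha>] pos_root_coeffs[of "- \<alpha>"] by (metis minus_minus)

text \<open>Applied twice: to show that no root straddles two components, and that the difference of
  two simple roots is not a screener.\<close>

lemma no_mixed_signs:
  assumes "\<alpha> \<in> R" "\<alpha> = (\<Sum>\<delta>\<in>simples. f \<delta> *\<^sub>R \<delta>)" "x \<in> simples" "y \<in> simples" "0 < f x" "f y < 0"
  shows False
proof -
  obtain k :: "'a \<Rightarrow> nat" where "\<alpha> = (\<Sum>\<delta>\<in>simples. real (k \<delta>) *\<^sub>R \<delta>) \<or> \<alpha> = - (\<Sum>\<delta>\<in>simples. real (k \<delta>) *\<^sub>R \<delta>)"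
    using root_coeffs[OF assms(1)] by blast
  then have "(\<Sum>\<delta>\<in>simples. f \<delta> *\<^sub>R \<delta>) = (\<Sum>\<delta>\<in>simples. real (k \<delta>) *\<^sub>R \<delta>) \<or>
      (\<Sum>\<delta>\<in>simples. f \<delta> *\<^sub>R \<delta>) = (\<Sum>\<delta>\<in>simples. (- real (k \<delta>)) *\<^sub>R \<delta>)"
    using assms(2) by (simp add: sum_negf)
  then have "f y = real (k y) \<or> f x = - real (k x)"
    using simples_unique[OF _ assms(4), of f "\<lambda>\<delta>. real (k \<delta>)"]
      simples_unique[OF _ assms(3), of f "\<lambda>\<delta>. - real (k \<delta>)"] by blast
  then show False using assms(5,6) by auto
qed

section \<open>Decomposition into orthogonal components\<close>

definition linked :: "('a \<times> 'a) set" where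
  "linked = {(x, y). x \<in> simples \<and> y \<in> simples \<and> x \<bullet> y \<noteq> 0}"

definition component :: "'a \<Rightarrow> 'a set" where
  "component x = linked\<^sup>* `` {x}"

lemma linked_rtrancl_sym: "(x, y) \<in> linked\<^sup>* \<Longrightarrow> (y, x) \<in> linked\<^sup>*"
proof -
  have "sym linked" by (auto simp: linked_def sym_def inner_commute)
  then show "(x, y) \<in> linked\<^sup>* \<Longrightarrow> (y, x) \<in> linked\<^sup>*" using sym_rtrancl symD by metis
qed

lemma component_refl: "x \<in> component x"
  by (simp add: component_def)

lemma component_eq: "y \<in> component x \<Longrightarrow> component y = component x"
  unfolding component_def using linked_rtrancl_sym by (auto intro: rtrancl_trans)

lemma component_simples: "x \<in> simples \<Longrightarrow> component x \<subseteq> simples"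
proof
  fix y assume x: "x \<in> simples" and "y \<in> component x"
  then have "(x, y) \<in> linked\<^sup>*" by (simp add: component_def)
  then show "y \<in> simples" using x by induction (auto simp: linked_def)
qed

lemma component_orthogonal:
  assumes "x \<in> simples" "y \<in> simples" "component x \<noteq> component y" "u \<in> component x" "v \<in> component y"
  shows "u \<bullet> v = 0"
proof (rule ccontr)
  assume "u \<bullet> v \<noteq> 0"
  then have "(u, v) \<in> linked" using assms component_simples by (auto simp: linked_def)
  then have "v \<in> component u" by (auto simp: component_def)
  then show False using assms component_eq by metis
qed

lemma span_component_orthogonal:
  assumes "x \<in> simples" "y \<in> simples" "component x \<noteq> component y"
    "u \<in> span (component x)" "v \<in> span (component y)"
  shows "orthogonal u v"
proof -
  have "orthogonal a v" if "a \<in> component x" for a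
    using component_orthogonal[OF assms(1-3) that] assms(5) by (intro orthogonal_to_span[of v]) (auto simp: orthogonal_def)
  then show ?thesis using assms(4) by (metis orthogonal_commute orthogonal_to_span)
qed

lemma coeff_outside:
  assumes "C \<subseteq> simples" "\<alpha> \<in> span C" "\<alpha> = (\<Sum>\<delta>\<in>simples. f \<delta> *\<^sub>R \<delta>)" "\<delta> \<in> simples" "\<delta> \<notin> C"
  shows "f \<delta> = 0"
proof -
  have fin: "finite C" using assms finite_simples finite_subset by blast
  obtain u where "\<alpha> = (\<Sum>\<delta>\<in>C. u \<delta> *\<^sub>R \<delta>)" using assms(2) by (auto simp: span_finite[OF fin])
  also have "\<dots> = (\<Sum>\<delta>\<in>simples. (if \<delta> \<in> C then u \<delta> else 0) *\<^sub>R \<delta>)"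
    using assms(1) finite_simples by (intro sum.mono_neutral_cong_left) auto
  finally show ?thesis using simples_unique[of f "\<lambda>\<delta>. if \<delta> \<in> C then u \<delta> else 0"] assms by auto
qed

text \<open>If the summands lay in different components they would be orthogonal, and reflecting
  their sum in the first would give the root \<open>\<beta> - \<alpha>\<close>, whose coefficients
  have both signs.\<close>

lemma pos_root_component: "\<alpha> \<in> pos_roots \<Longrightarrow> \<exists>x\<in>simples. \<alpha> \<in> span (component x)"
proof (induction rule: pos_root_induct)
  case (simple \<alpha>)
  then show ?case using component_refl span_base by blast
next
  case (sum \<alpha> \<beta>)
  then obtain x y where x: "x \<in> simples" "\<alpha> \<in> span (component x)" and y: "y \<in> simples" "\<beta> \<in> span (component y)"
    by blast
  show ?case
  proof (cases "component x = component y")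
    case True
    then show ?thesis using x y span_add by metis
  next
    case False
    have orth: "\<alpha> \<bullet> \<beta> = 0"
      using span_component_orthogonal[OF x(1) y(1) False x(2) y(2)] by (simp add: orthogonal_def)
    have R: "\<alpha> \<in> R" "\<alpha> + \<beta> \<in> R" "\<alpha> \<noteq> 0" "\<beta> \<noteq> 0" using sum nonzero by (auto simp: pos_roots_def)
    have "root_reflection \<alpha> (\<alpha> + \<beta>) = \<beta> - \<alpha>"
      using R orth by (simp add: root_reflection_def inner_add_left inner_commute[of \<beta>] scaleR_2)
    then have mixed: "\<beta> - \<alpha> \<in> R" using refl_mem[OF R(1,2)] by simp
    obtain k l :: "'a \<Rightarrow> nat" where kl: "\<alpha> = (\<Sum>\<delta>\<in>simples. real (k \<delta>) *\<^sub>R \<delta>)" "\<beta> = (\<Sum>\<delta>\<in>simples. real (l \<delta>) *\<^sub>R \<delta>)"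
      using pos_root_coeffs sum by blast
    have "\<exists>a\<in>simples. k a \<noteq> 0"
    proof (rule ccontr)
      assume "\<not> (\<exists>a\<in>simples. k a \<noteq> 0)"
      then have "\<alpha> = 0" by (subst kl(1)) (auto intro!: sum.neutral)
      then show False using R by simp
    qed
    then obtain a where a: "a \<in> simples" "k a \<noteq> 0" by blast
    have "\<exists>b\<in>simples. l b \<noteq> 0"
    proof (rule ccontr)
      assume "\<not> (\<exists>b\<in>simples. l b \<noteq> 0)"
      then have "\<beta> = 0" by (subst kl(2)) (auto intro!: sum.neutral)
      then show False using R by simp
    qed
    then obtain b where b: "b \<in> simples" "l b \<noteq> 0" by blast
    have "a \<in> component x" using coeff_outside[OF component_simples[OF x(1)] x(2) kl(1) a(1)] a by auto
    moreover have bC: "b \<in> component y" using coeff_outside[OF component_simples[OF y(1)] y(2) kl(2) b(1)] b by auto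
    ultimately have "a \<notin> component y" "b \<notin> component x" using False component_eq by metis+
    then have "l a = 0" "k b = 0"
      using coeff_outside[OF component_simples[OF y(1)] y(2) kl(2) a(1)]
        coeff_outside[OF component_simples[OF x(1)] x(2) kl(1) b(1)] by auto
    then have "real (l a) - real (k a) < 0" "0 < real (l b) - real (k b)" using a b by auto
    moreover have "\<beta> - \<alpha> = (\<Sum>\<delta>\<in>simples. (real (l \<delta>) - real (k \<delta>)) *\<^sub>R \<delta>)"
      by (simp only: kl scaleR_diff_left sum_subtractf)
    ultimately show ?thesis using no_mixed_signs[OF mixed _ b(1) a(1), of "\<lambda>\<delta>. real (l \<delta>) - real (k \<delta>)"] by blast
  qed
qed

lemma root_component: "\<alpha> \<in> R \<Longrightarrow> \<exists>x\<in>simples. \<alpha> \<in> span (component x)"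
  using pos_or_neg[of \<alpha>] pos_root_component[of \<alpha>] pos_root_component[of "- \<alpha>"] span_neg by force

lemma root_system_inter_span:
  assumes "C \<subseteq> R" shows "root_system (R \<inter> span C)"
  unfolding root_system_def
proof (intro conjI ballI allI impI)
  fix \<alpha> assume a: "\<alpha> \<in> R \<inter> span C"
  show "root_reflection \<alpha> ` (R \<inter> span C) = R \<inter> span C"
    using a refl_mem by (intro reflection_image) (auto simp: root_reflection_def intro!: span_diff span_scale)
qed (use root_sys in \<open>auto simp: root_system_def\<close>)

lemma root_base_inter_span:
  assumes C: "C \<subseteq> simples" shows "root_base (R \<inter> span C) C"
  unfolding root_base_def
proof (intro conjI ballI)
  show "C \<subseteq> R \<inter> span C" using C simples_R span_base by auto
  show "finite C" using C finite_simples finite_subset by blast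
  show "independent C" using C independent_simples independent_mono by blast
  have restrict: "(\<Sum>\<delta>\<in>simples. real (k \<delta>) *\<^sub>R \<delta>) = (\<Sum>\<delta>\<in>C. real (k \<delta>) *\<^sub>R \<delta>)"
    if "(\<Sum>\<delta>\<in>simples. real (k \<delta>) *\<^sub>R \<delta>) \<in> span C" for k :: "'a \<Rightarrow> nat"
    using coeff_outside[OF C that refl] C finite_simples by (intro sum.mono_neutral_right) auto
  fix \<beta> assume "\<beta> \<in> R \<inter> span C"
  then obtain k :: "'a \<Rightarrow> nat" where k: "\<beta> = (\<Sum>\<delta>\<in>simples. real (k \<delta>) *\<^sub>R \<delta>) \<or> \<beta> = - (\<Sum>\<delta>\<in>simples. real (k \<delta>) *\<^sub>R \<delta>)"
    and "\<beta> \<in> span C" using root_coeffs by blast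
  then have "(\<Sum>\<delta>\<in>simples. real (k \<delta>) *\<^sub>R \<delta>) \<in> span C" using span_neg by fastforce
  then show "\<exists>k::'a \<Rightarrow> nat. \<beta> = (\<Sum>\<delta>\<in>C. real (k \<delta>) *\<^sub>R \<delta>) \<or> \<beta> = - (\<Sum>\<delta>\<in>C. real (k \<delta>) *\<^sub>R \<delta>)"
    using k restrict by metis
qed

text \<open>The maximality condition passes to a component because a simple root outside it has
  Cartan number 0 with \<open>u - w\<close>, so the non-integral witness lies inside.\<close>

lemma component_diagram:
  assumes x: "x \<in> simples"
    and max: "\<And>x y. x \<in> simples \<Longrightarrow> y \<in> simples \<Longrightarrow> x \<noteq> y \<Longrightarrow>
      \<exists>z\<in>simples. 2 * (z \<bullet> (x - y)) / ((x - y) \<bullet> (x - y)) \<notin> \<int>"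
  shows "screening_diagram (component x) h"
proof
  note sub = component_simples[OF x]
  show "finite (component x)" using sub finite_simples finite_subset by blast
  show "0 < h \<bullet> y" if "y \<in> component x" for y using that sub simples_pos by blast
  show "y \<bullet> z \<le> 0" if "y \<in> component x" "z \<in> component x" "y \<noteq> z" for y z
    using that sub simples_obtuse by blast
  show "2 * (y \<bullet> z) / (z \<bullet> z) \<in> \<int>" if "y \<in> component x" "z \<in> component x" for y z
    using that sub simples_R by (intro cartan) auto
  show "component x \<noteq> {}" using component_refl by blast
  show "\<exists>u\<in>X. \<exists>w\<in>component x - X. u \<bullet> w \<noteq> 0"
    if X: "X \<subseteq> component x" "X \<noteq> {}" "X \<noteq> component x" for X
  proof (rule ccontr)
    assume no: "\<not> (\<exists>u\<in>X. \<exists>w\<in>component x - X. u \<bullet> w \<noteq> 0)"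
    obtain y where y: "y \<in> X" using X by blast
    have "component y \<subseteq> X"
    proof
      fix z assume "z \<in> component y"
      then have "(y, z) \<in> linked\<^sup>*" by (simp add: component_def)
      then show "z \<in> X"
      proof induction
        case (step z w)
        then have "w \<in> component z" by (auto simp: component_def)
        then have "w \<in> component x" using component_eq[of z x] step X by auto
        then show ?case using no step by (auto simp: linked_def)
      qed (rule y)
    qed
    then show False using component_eq[of y x] y X by auto
  qed
  show "\<exists>z\<in>component x. 2 * (z \<bullet> (u - w)) / ((u - w) \<bullet> (u - w)) \<notin> \<int>"
    if uw: "u \<in> component x" "w \<in> component x" "u \<noteq> w" for u w
  proof -
    obtain z where z: "z \<in> simples" "2 * (z \<bullet> (u - w)) / ((u - w) \<bullet> (u - w)) \<notin> \<int>"
      using max[of u w] uw sub by blast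
    have "z \<in> component x"
    proof (rule ccontr)
      assume "z \<notin> component x"
      then have ne: "component z \<noteq> component x" using component_refl by metis
      have "z \<bullet> u = 0" "z \<bullet> w = 0"
        using component_orthogonal[OF z(1) x ne component_refl] uw by auto
      then show False using z(2) by (simp add: inner_diff_right)
    qed
    then show ?thesis using z by blast
  qed
qed

lemma classification:
  assumes max: "\<And>x y. x \<in> simples \<Longrightarrow> y \<in> simples \<Longrightarrow> x \<noteq> y \<Longrightarrow>
      \<exists>z\<in>simples. 2 * (z \<bullet> (x - y)) / ((x - y) \<bullet> (x - y)) \<notin> \<int>"
  shows "\<exists>\<C>. roots_of_orthogonal_sum R \<C> \<and> (\<forall>X\<in>\<C>. \<exists>t\<in>maximal_types. rescaled_root_system_of_type X t)"
proof (intro exI conjI ballI)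
  \<comment> \<open>Simple roots of one component yield the same set, so distinct members come from
    distinct components and are orthogonal.\<close>
  let ?C = "(\<lambda>x. R \<inter> span (component x)) ` simples"
  show "roots_of_orthogonal_sum R ?C"
    unfolding roots_of_orthogonal_sum_def
  proof (intro conjI ballI impI)
    show "finite ?C" using finite_simples by simp
    show "R = \<Union> ?C" using root_component by auto
    fix X Y u v assume "X \<in> ?C" "Y \<in> ?C" and ne: "X \<noteq> Y" and uv: "u \<in> X" "v \<in> Y"
    then obtain x y where "x \<in> simples" "y \<in> simples"
      "X = R \<inter> span (component x)" "Y = R \<inter> span (component y)" by blast
    moreover from this have "component x \<noteq> component y" using ne by auto
    ultimately show "orthogonal u v" using span_component_orthogonal[of x y u v] uv by auto
  qed
  fix X assume "X \<in> ?C"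
  then obtain x where x: "x \<in> simples" "X = R \<inter> span (component x)" by blast
  note sub = component_simples[OF x(1)]
  interpret screening_diagram "component x" h by (rule component_diagram[OF x(1) max])
  obtain t where t: "t \<in> maximal_types" "has_cartan_type (component x) t" using diagram_type by blast
  have "root_system X" using x root_system_inter_span sub simples_R by auto
  moreover have "root_base X (component x)" using x root_base_inter_span sub by auto
  ultimately have "rescaled_root_system_of_type X t"
    using t(2) unfolding rescaled_root_system_of_type_def has_cartan_type_def by metis
  then show "\<exists>t\<in>maximal_types. rescaled_root_system_of_type X t" using t(1) by blast
qed

end


section \<open>The screeners of an even lattice as a root system\<close>

lemma int_span_induct [consumes 1, case_names zero step]:
  assumes "x \<in> module.span int_scale S" "P 0"
    and "\<And>c x y. x \<in> S \<Longrightarrow> P y \<Longrightarrow> P (of_int c *\<^sub>R x + y)"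
  shows "P x"
  using module.span_induct_alt[OF module_int_scale assms(1), of P] assms(2,3) by blast

locale even_lattice =
  fixes L :: "'a::euclidean_space set"
  assumes lattice: "pos_def_even_lattice L"
begin

lemma span_L: obtains B where "finite B" "L = module.span int_scale B"
  using lattice unfolding pos_def_even_lattice_def by blast

lemma L_diff: "x \<in> L \<Longrightarrow> y \<in> L \<Longrightarrow> x - y \<in> L"
  and L_scale: "x \<in> L \<Longrightarrow> of_int k *\<^sub>R x \<in> L"
  and L_zero: "0 \<in> L"
  using span_L module.span_diff[OF module_int_scale] module.span_scale[OF module_int_scale]
    module.span_zero[OF module_int_scale] by metis+

lemma L_inner: "x \<in> L \<Longrightarrow> y \<in> L \<Longrightarrow> x \<bullet> y \<in> \<int>"
  using lattice unfolding pos_def_even_lattice_def by blast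

text \<open>The norm of a lattice vector is an integer, so the scaled vector lies in the rational
  span automatically and the dual lattice reduces to integrality of Cartan numbers.\<close>

lemma screener_iff:
  "\<beta> \<in> screeners L \<longleftrightarrow>
    \<beta> \<in> L \<and> \<beta> \<notin> (\<lambda>\<gamma>. 2 *\<^sub>R \<gamma>) ` L \<and> (\<forall>\<alpha>\<in>L. 2 * (\<alpha> \<bullet> \<beta>) / (\<beta> \<bullet> \<beta>) \<in> \<int>)"
proof (cases "\<beta> \<in> L")
  case True
  then obtain k :: int where k: "\<beta> \<bullet> \<beta> = 2 * of_int k"
    using lattice unfolding pos_def_even_lattice_def by blast
  have "rat_scale (2 / (2 * of_int k)) \<beta> \<in> module.span rat_scale L"
    by (intro module.span_scale[OF module_rat_scale] module.span_base[OF module_rat_scale] True)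
  then have "(2 / (\<beta> \<bullet> \<beta>)) *\<^sub>R \<beta> \<in> module.span rat_scale L"
    by (simp add: k of_rat_divide of_rat_mult)
  then show ?thesis by (simp add: screeners_def dual_lattice_def)
qed (simp add: screeners_def)

lemma screener_L: "\<beta> \<in> screeners L \<Longrightarrow> \<beta> \<in> L"
  and screener_Ints: "\<beta> \<in> screeners L \<Longrightarrow> \<alpha> \<in> L \<Longrightarrow> 2 * (\<alpha> \<bullet> \<beta>) / (\<beta> \<bullet> \<beta>) \<in> \<int>"
  by (auto simp: screener_iff)

lemma screener_nonzero: "\<beta> \<in> screeners L \<Longrightarrow> \<beta> \<noteq> 0"
  using L_zero by (force simp: screener_iff image_iff)

text \<open>Being an integral combination of \<open>B\<close>, the vector is orthogonal to itself.
  Hence inner products with \<open>B\<close> determine a lattice vector, and bounding these integers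
  leaves finitely many screeners.\<close>

lemma eq_zero_if_orthogonal:
  assumes "x \<in> L" "L = module.span int_scale B" "\<And>b. b \<in> B \<Longrightarrow> b \<bullet> x = 0" shows "x = 0"
proof -
  have "y \<bullet> x = 0" if "y \<in> L" for y
    using that unfolding assms(2)
    by (induction rule: int_span_induct) (auto simp: inner_add_left assms(3))
  then show ?thesis using assms(1) by (metis inner_eq_zero_iff)
qed

text \<open>A screener is not orthogonal to the whole basis, and the integrality of its Cartan number with
  a basis vector bounds its length.\<close>

lemma finite_screeners: "finite (screeners L)"
proof -
  obtain B where B: "finite B" "L = module.span int_scale B" using span_L .
  have BL: "b \<in> L" if "b \<in> B" for b
    unfolding B by (rule module.span_base[OF module_int_scale that])
  define m where "m = 2 * (\<Sum>b\<in>B. norm b)"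
  define F where "F \<beta> = restrict (\<lambda>b. b \<bullet> \<beta>) B" for \<beta> :: 'a
  have norm_le: "norm \<beta> \<le> m" if s: "\<beta> \<in> screeners L" for \<beta>
  proof -
    obtain b where b: "b \<in> B" "b \<bullet> \<beta> \<noteq> 0"
      using eq_zero_if_orthogonal[OF screener_L[OF s] B(2)] screener_nonzero[OF s] by blast
    have p: "0 < \<beta> \<bullet> \<beta>" using screener_nonzero[OF s] by simp
    have "1 \<le> \<bar>2 * (b \<bullet> \<beta>) / (\<beta> \<bullet> \<beta>)\<bar>"
      using screener_Ints[OF s BL[OF b(1)]] b p by (intro Ints_nonzero_abs_ge1) auto
    then have "\<beta> \<bullet> \<beta> \<le> 2 * \<bar>b \<bullet> \<beta>\<bar>" using p by (simp add: abs_mult pos_le_divide_eq)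
    also have "\<dots> \<le> 2 * (norm b * norm \<beta>)" using Cauchy_Schwarz_ineq2[of b \<beta>] by simp
    finally have "norm \<beta> * norm \<beta> \<le> (2 * norm b) * norm \<beta>" by (simp add: dot_square_norm power2_eq_square)
    then have "norm \<beta> \<le> 2 * norm b" using p by simp
    also have "norm b \<le> (\<Sum>b\<in>B. norm b)" using b B by (intro member_le_sum) auto
    finally show ?thesis by (simp add: m_def)
  qed
  have "F ` screeners L \<subseteq> (\<Pi>\<^sub>E b\<in>B. {k \<in> \<int>. \<bar>k\<bar> \<le> norm b * m})"
  proof (intro image_subsetI PiE_I)
    fix \<beta> b assume s: "\<beta> \<in> screeners L" and b: "b \<in> B"
    have "\<bar>b \<bullet> \<beta>\<bar> \<le> norm b * norm \<beta>" by (rule Cauchy_Schwarz_ineq2)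
    also have "\<dots> \<le> norm b * m" using norm_le[OF s] by (intro mult_left_mono) auto
    finally show "F \<beta> b \<in> {k \<in> \<int>. \<bar>k\<bar> \<le> norm b * m}"
      using b L_inner[OF BL[OF b] screener_L[OF s]] by (simp add: F_def)
  qed (simp add: F_def)
  moreover have "finite (\<Pi>\<^sub>E b\<in>B. {k \<in> \<int>. \<bar>k\<bar> \<le> norm b * m})"
    using B by (intro finite_PiE finite_abs_int_segment)
  ultimately have "finite (F ` screeners L)" by (rule finite_subset)
  moreover have "inj_on F (screeners L)"
  proof (rule inj_onI)
    fix x y assume xy: "x \<in> screeners L" "y \<in> screeners L" "F x = F y"
    have "b \<bullet> (x - y) = 0" if "b \<in> B" for b
      using fun_cong[OF xy(3), of b] that by (simp add: F_def inner_diff_right)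
    then show "x = y" using eq_zero_if_orthogonal[OF L_diff B(2), of x y] xy screener_L by auto
  qed
  ultimately show ?thesis by (rule finite_imageD)
qed

lemma reflection_L: "\<alpha> \<in> screeners L \<Longrightarrow> x \<in> L \<Longrightarrow> root_reflection \<alpha> x \<in> L"
  using screener_Ints[of \<alpha> x] L_diff L_scale[OF screener_L, of \<alpha>]
  by (auto simp: root_reflection_def elim!: Ints_cases)

text \<open>The reflection is an isometric involution of L, so it respects both primitivity and
  integrality of Cartan numbers.\<close>

lemma reflection_screener:
  assumes "\<alpha> \<in> screeners L" "\<beta> \<in> screeners L" shows "root_reflection \<alpha> \<beta> \<in> screeners L"
  unfolding screener_iff
proof (intro conjI ballI)
  let ?r = "root_reflection \<alpha>"
  show "?r \<beta> \<in> L" using reflection_L[OF assms(1) screener_L[OF assms(2)]] .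
  show "?r \<beta> \<notin> (\<lambda>\<gamma>. 2 *\<^sub>R \<gamma>) ` L"
  proof
    assume "?r \<beta> \<in> (\<lambda>\<gamma>. 2 *\<^sub>R \<gamma>) ` L"
    then obtain \<gamma> where g: "\<gamma> \<in> L" "?r \<beta> = 2 *\<^sub>R \<gamma>" by blast
    then have "\<beta> = 2 *\<^sub>R ?r \<gamma>" by (metis reflection_involution reflection_scale)
    then show False using assms(2) reflection_L[OF assms(1) g(1)] by (auto simp: screener_iff)
  qed
  fix x assume "x \<in> L"
  then show "2 * (x \<bullet> ?r \<beta>) / (?r \<beta> \<bullet> ?r \<beta>) \<in> \<int>"
    using screener_Ints[OF assms(2) reflection_L[OF assms(1)], of x]
    unfolding reflection_isometry by (simp only: reflection_inner)
qed

text \<open>The Cartan numbers \<open>2 * c\<close> and \<open>2 / c\<close> are integers with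
  product 4, which leaves 1/2, 1 and 2 for the absolute value of \<open>c\<close>. Primitivity of
  \<open>c *\<^sub>R \<alpha>\<close> rules out 2, that of \<open>\<alpha>\<close> rules out
  1/2.\<close>

lemma screener_multiple:
  assumes "\<alpha> \<in> screeners L" "c *\<^sub>R \<alpha> \<in> screeners L" shows "c = 1 \<or> c = -1"
proof -
  have nz: "\<alpha> \<bullet> \<alpha> \<noteq> 0" "c \<noteq> 0" using assms screener_nonzero by force+
  have "2 * c \<in> \<int>" using screener_Ints[OF assms(1) screener_L[OF assms(2)]] nz by simp
  then obtain m :: int where m: "2 * c = of_int m" by (auto elim: Ints_cases)
  have "2 / c \<in> \<int>" using screener_Ints[OF assms(2) screener_L[OF assms(1)]] nz by simp
  then obtain n :: int where n: "2 / c = of_int n" by (auto elim: Ints_cases)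
  have "of_int (m * n) = (4::real)" using nz by (simp add: m[symmetric] n[symmetric])
  then have mn: "m * n = 4" by linarith
  then have "\<bar>m\<bar> dvd 4" by (metis abs_dvd_iff dvd_triv_left)
  then have "\<bar>m\<bar> \<le> 4" by (rule zdvd_imp_le) simp
  then have "m \<in> {-4, -3, -2, -1, 0, 1, 2, 3, 4}" by (auto simp: abs_le_iff)
  then have "m \<in> {-4, -2, -1, 1, 2, 4}" using mn by (auto, presburger+)
  moreover have "\<bar>c\<bar> \<noteq> 2"
  proof
    assume "\<bar>c\<bar> = 2"
    then have "c *\<^sub>R \<alpha> = 2 *\<^sub>R (of_int (if c = 2 then 1 else -1) *\<^sub>R \<alpha>)" by (auto simp: abs_if split: if_splits)
    then show False using assms(2) L_scale[OF screener_L[OF assms(1)]] unfolding screener_iff by blast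
  qed
  moreover have "\<bar>c\<bar> \<noteq> 1 / 2"
  proof
    assume "\<bar>c\<bar> = 1 / 2"
    then have "c = 1 / 2 \<or> c = - 1 / 2" by linarith
    then have "\<alpha> = 2 *\<^sub>R (of_int (if c = 1 / 2 then 1 else -1) *\<^sub>R (c *\<^sub>R \<alpha>))"
      by (elim disjE; hypsubst) simp_all
    then show False using assms(1) L_scale[OF screener_L[OF assms(2)]] unfolding screener_iff by blast
  qed
  ultimately show ?thesis using m by auto
qed

lemma root_system_screeners: "root_system (screeners L)"
  unfolding root_system_def
proof (intro conjI ballI allI impI)
  show "root_reflection \<alpha> ` screeners L = screeners L" if "\<alpha> \<in> screeners L" for \<alpha>
    using reflection_screener[OF that] by (rule reflection_image)
qed (use finite_screeners screener_nonzero screener_Ints screener_L screener_multiple in blast)+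

end

theorem theorem5p16:
  fixes L :: "'a::euclidean_space set"
  assumes "pos_def_even_lattice L"
    and "generated_by_screening_system L"
  shows "\<exists>\<C>. roots_of_orthogonal_sum (screeners L) \<C> \<and>
    (\<forall>X\<in>\<C>. \<exists>t \<in> {Type_A 1, Type_B 2, Type_G2, Type_B 3, Type_C 3, Type_B 4, Type_F4,
                    Type_E 6, Type_E 7, Type_E 8}
                \<union> {Type_A n | n. n \<ge> 4} \<union> {Type_B n | n. n > 4} \<union> {Type_C n | n. n > 4}.
       rescaled_root_system_of_type X t)"
proof -
  interpret even_lattice L using assms(1) by unfold_locales
  obtain h where h: "\<And>\<alpha>. \<alpha> \<in> screeners L \<Longrightarrow> h \<bullet> \<alpha> \<noteq> 0"
    using generic_functional[OF finite_screeners] screener_nonzero by metis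
  interpret generic_root_system "screeners L" h
    using root_system_screeners h by unfold_locales
  obtain S where S: "S \<subseteq> screeners L" "L = module.span int_scale S"
    using assms(2) unfolding generated_by_screening_system_def screening_system_def by blast
  \<comment> \<open>Here generation by screeners enters: each screener is an integral combination of
    simple roots, so the simple roots generate all of L.\<close>
  have comb: "\<exists>c::'a \<Rightarrow> int. x = (\<Sum>\<delta>\<in>simples. of_int (c \<delta>) *\<^sub>R \<delta>)" if "x \<in> L" for x
  proof -
    have "x \<in> module.span int_scale S" using that S(2) by simp
    then show ?thesis
    proof (induction rule: int_span_induct)
      case zero
      show ?case by (intro exI[of _ "\<lambda>_. 0"]) simp
    next
      case (step a x y)
      then obtain c :: "'a \<Rightarrow> int" where c: "y = (\<Sum>\<delta>\<in>simples. of_int (c \<delta>) *\<^sub>R \<delta>)" by blast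
      obtain k :: "'a \<Rightarrow> nat" where "x = (\<Sum>\<delta>\<in>simples. real (k \<delta>) *\<^sub>R \<delta>) \<or> x = - (\<Sum>\<delta>\<in>simples. real (k \<delta>) *\<^sub>R \<delta>)"
        using root_coeffs[of x] step S(1) by blast
      then obtain e :: int where "x = of_int e *\<^sub>R (\<Sum>\<delta>\<in>simples. real (k \<delta>) *\<^sub>R \<delta>)"
        by (metis of_int_1 of_int_minus scaleR_minus1_left scaleR_one)
      then have "of_int a *\<^sub>R x + y = (\<Sum>\<delta>\<in>simples. of_int (a * e * int (k \<delta>) + c \<delta>) *\<^sub>R \<delta>)"
        by (simp add: c scaleR_sum_right scaleR_add_left sum.distrib mult.assoc)
      then show ?case by (intro exI[of _ "\<lambda>\<delta>. a * e * int (k \<delta>) + c \<delta>"])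
    qed
  qed
  have "\<exists>z\<in>simples. 2 * (z \<bullet> (x - y)) / ((x - y) \<bullet> (x - y)) \<notin> \<int>"
    if xy: "x \<in> simples" "y \<in> simples" "x \<noteq> y" for x y
  proof (rule ccontr)
    assume no: "\<not> (\<exists>z\<in>simples. 2 * (z \<bullet> (x - y)) / ((x - y) \<bullet> (x - y)) \<notin> \<int>)"
    \<comment> \<open>The coordinates of \<open>x - y\<close> serve twice: the odd coordinate 1
      keeps it out of 2L, and the opposite signs of 1 and -1 keep it from being a root.\<close>
    let ?f = "\<lambda>\<delta>. if \<delta> = x then 1 else if \<delta> = y then -1 else 0 :: real"
    have "(\<Sum>\<delta>\<in>simples. ?f \<delta> *\<^sub>R \<delta>) = (\<Sum>\<delta>\<in>simples. (if \<delta> = x then x else 0) - (if \<delta> = y then y else 0))"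
      using xy(3) by (intro sum.cong) auto
    also have "\<dots> = x - y" using xy finite_simples by (simp add: sum_subtractf)
    finally have f: "x - y = (\<Sum>\<delta>\<in>simples. ?f \<delta> *\<^sub>R \<delta>)" by simp
    have "x - y \<in> screeners L" unfolding screener_iff
    proof (intro conjI ballI notI)
      show "x - y \<in> L" using xy simples_R screener_L by (intro L_diff) auto
    next
      assume "x - y \<in> (\<lambda>\<gamma>. 2 *\<^sub>R \<gamma>) ` L"
      then obtain \<gamma> where g: "\<gamma> \<in> L" "x - y = 2 *\<^sub>R \<gamma>" by blast
      obtain c :: "'a \<Rightarrow> int" where "\<gamma> = (\<Sum>\<delta>\<in>simples. of_int (c \<delta>) *\<^sub>R \<delta>)" using comb[OF g(1)] by blast
      then have "(\<Sum>\<delta>\<in>simples. ?f \<delta> *\<^sub>R \<delta>) = (\<Sum>\<delta>\<in>simples. of_int (2 * c \<delta>) *\<^sub>R \<delta>)"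
        using g(2) f by (simp add: scaleR_sum_right)
      then have "?f x = of_int (2 * c x)" by (rule simples_unique) (rule xy)
      then have "of_int (2 * c x) = (of_int 1 :: real)" by simp
      then show False unfolding of_int_eq_iff by presburger
    next
      \<comment> \<open>The Cartan number with \<open>x - y\<close> is linear in \<open>z\<close>,
        so integrality on the simple roots extends to the lattice that they generate.\<close>
      fix z assume "z \<in> L"
      then obtain c :: "'a \<Rightarrow> int" where c: "z = (\<Sum>\<delta>\<in>simples. of_int (c \<delta>) *\<^sub>R \<delta>)" using comb by blast
      have "2 * (z \<bullet> (x - y)) / ((x - y) \<bullet> (x - y)) =
          (\<Sum>\<delta>\<in>simples. of_int (c \<delta>) * (2 * (\<delta> \<bullet> (x - y)) / ((x - y) \<bullet> (x - y))))"
        unfolding c inner_sum_left by (simp add: sum_divide_distrib sum_distrib_left mult_ac)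
      also have "\<dots> \<in> \<int>" using no by (intro Ints_sum Ints_mult) auto
      finally show "2 * (z \<bullet> (x - y)) / ((x - y) \<bullet> (x - y)) \<in> \<int>" .
    qed
    then show False using no_mixed_signs[OF _ f xy(1,2)] xy(3) by simp
  qed
  from classification[OF this] show ?thesis unfolding maximal_types_def .
qed

end
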